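(* Let $(Y,S)$ be a topological dynamical system, let $\mathbf{F}=\{\mathbf{f}_n\}_{n=1}^\infty$ be a block sub-additive potential on $Y$, let $\mu\in M(Y,S)$ and let $\mathcal{U}\in\mathcal{C}_Y^o$ be an open cover of $Y$. Let $\mathcal{F}=\{f_n\}_{n=1}^\infty$, $f_n(y)=\mathbf{f}_n(y,Sy,\ldots,S^{n-1}y)$, be the sub-additive potential induced by $\mathbf{F}$, and assume $\mathcal{F}_*(\mu)>-\infty$. Then $$GP_\mu(S,\mathbf{F},\mathcal{U})\le h_\mu(S,\mathcal{U})+\mathcal{F}_*(\mu).$$ If additionally $\mu$ is ergodic, then $$GP_\mu(S,\mathbf{F},\mathcal{U})=h_\mu(S,\mathcal{U})+\mathcal{F}_*(\mu).$$
   Context: A topological dynamical system (TDS) $(Y,S)$ is a compact metric space $Y$ with metric $d$ together with a continuous surjective map $S:Y\to Y$ (not assumed invertible). $C(Z)$ is the space of real-valued continuous functions on $Z$; $M(Y)$ is the set of Borel probability measures on $Y$, and $M(Y,S)$ is the subset of $S$-invariant ones. A block sub-additive potential on $Y$ is a sequence $\mathbf{F}=\{\mathbf{f}_n\}_{n=1}^\infty$ with $\mathbf{f}_n\in C(Y^n)$ such that $\mathbf{f}_{n+m}(x_0,\ldots,x_{n+m-1})\le \mathbf{f}_n(x_0,\ldots,x_{n-1})+\mathbf{f}_m(x_n,\ldots,x_{n+m-1})$ for all $m,n\ge 1$ and all points. The induced sequence $f_n(y)=\mathbf{f}_n(y,Sy,\ldots,S^{n-1}y)$ satisfies $f_{m+n}(y)\le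 f_m(y)+f_n(S^my)$, and $\mathcal{F}_*(\mu)=\lim_{n\to\infty}\frac1n\int f_n\,d\mu$ (the limit exists by sub-additivity). Covers: for a subset $K$ of a compact metric space $Z$, a cover of $K$ is a finite family of Borel subsets of $K$ whose union is $K$; $\mathcal{C}_K$ is the set of all covers of $K$, $\mathcal{C}_K^o$ the set of those consisting of relatively open sets, and $\mathcal{P}_K$ the set of those whose elements are pairwise disjoint (partitions). For $\mathcal{V}\in\mathcal{C}_K$ and $\mathcal{W}\in\mathcal{C}_Z$, $\mathcal{V}\succeq\mathcal{W}$ means every element of $\mathcal{V}$ is contained in some element of $\mathcal{W}$. For $\mathcal{U}\in\mathcal{C}_Y$: $\mathcal{U}^n=\{U_1\times\cdots\times U_n: U_i\in\mathcal{U}\}\in\mathcal{C}_{Y^n}$, and $\mathcal{U}_0^{n-1}=\bigvee_{j=0}^{n-1}S^{-j}\mathcal{U}$, where $\mathcal{U}\vee\mathcal{V}=\{U\cap V:U\in\mathcal{U},V\in\mathcal{V}\}$. Local entropy: for $\alpha\in\mathcal{P}_Y$, $H_\mu(\alpha)=-\sum_{A\in\alpha}\mu(A)\log\mu(A)$ (with $0\log 0=0$); for $\mathcal{U}\in\mathcal{C}_Y^o$, $H_\mu(\mathcal{U})=\inf\{H_\mu(\alpha):\alpha\in\mathcal{P}_Y,\alpha\succeq\mathcal{U}\}$ and $h_\mu(S,\mathcal{U})=\lim_{n\to\infty}\frac1nH_\mu(\mathcal{U}_0^{n-1})$. The quantity $h_\mu(S,\mathcal{U})+\mathcal{F}_*(\mu)$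 is also denoted $P_\mu(S,\mathcal{F},\mathcal{U})$. Average pseudo-orbits: for $\delta>0$ (and $n\ge2$), $Y^n_\delta$ is the set of $(x_0,\ldots,x_{n-1})\in Y^n$ with $\frac{1}{n-1}\sum_{i=0}^{n-2}d(Sx_i,x_{i+1})\le\delta$. Measure-theoretic pressure: for $\mu\in M(Y)$, a finite set $L\subset C(Y)$ and $\delta>0$, let $Y^n_{\delta,\mu,L}$ be the set of $(x_0,\ldots,x_{n-1})\in Y^n_\delta$ with $\max_{g\in L}|\frac1n\sum_{i=0}^{n-1}g(x_i)-\int g\,d\mu|\le\delta$. Put $GP_{n,\delta,\mu,L}(S,\mathbf{F},\mathcal{U})=\inf\{\sum_{V\in\mathcal{V}}\sup_{\mathbf{x}\in V}e^{\mathbf{f}_n(\mathbf{x})}:\mathcal{V}\in\mathcal{C}_{Y^n_{\delta,\mu,L}},\ \mathcal{V}\succeq\mathcal{U}^n\}$ (empty sets contribute $0$), with value $0$ if $Y^n_{\delta,\mu,L}=\emptyset$; $GP_{\delta,\mu,L}(S,\mathbf{F},\mathcal{U})=\limsup_{n\to\infty}\frac1n\log GP_{n,\delta,\mu,L}(S,\mathbf{F},\mathcal{U})$ with $\log0=-\infty$; and $GP_\mu(S,\mathbf{F},\mathcal{U})=\inf_{L}\inf_{\delta>0}GP_{\delta,\mu,L}(S,\mathbf{F},\mathcal{U})$, where $L$ ranges over finite subsets of $C(Y)$. *)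

theory Defs
  imports "HOL-Probability.Probability"
begin

text \<open>
  The compact metric space Y is the whole type \<^typ>\<open>'a::metric_space\<close>, whose compactness is a
  hypothesis.  The power Y^n consists of the functions from nat to Y restricted to {..<n}
  (extensional outside that set) with the product topology.
\<close>

definition tds :: "('a::metric_space \<Rightarrow> 'a) \<Rightarrow> bool" where
  "tds S \<longleftrightarrow> compact (UNIV :: 'a set) \<and> continuous_on UNIV S \<and> surj S"

definition power_topology :: "nat \<Rightarrow> (nat \<Rightarrow> 'a::metric_space) topology" where
  "power_topology n = product_topology (\<lambda>_. euclidean) {..<n}"


subsection \<open>Block sub-additive potentials\<close>

text \<open>Only the functions F n with n \<ge> 1 are constrained; F 0 plays no role.\<close>

definition block_subadditive :: "(nat \<Rightarrow> (nat \<Rightarrow> 'a::metric_space) \<Rightarrow> real) \<Rightarrow> bool" where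
  "block_subadditive F \<longleftrightarrow>
     (\<forall>n\<ge>1. continuous_map (power_topology n) euclideanreal (F n)) \<and>
     (\<forall>n\<ge>1. \<forall>m\<ge>1. \<forall>x \<in> topspace (power_topology (n + m)).
        F (n + m) x \<le> F n (\<lambda>i\<in>{..<n}. x i) + F m (\<lambda>i\<in>{..<m}. x (n + i)))"

definition induced_potential ::
    "('a \<Rightarrow> 'a) \<Rightarrow> (nat \<Rightarrow> (nat \<Rightarrow> 'a::metric_space) \<Rightarrow> real) \<Rightarrow> nat \<Rightarrow> 'a \<Rightarrow> real" where
  "induced_potential S F n y = F n (\<lambda>i\<in>{..<n}. (S ^^ i) y)"

text \<open>The limit is taken in the extended reals because it may be \<^term>\<open>-\<infinity> :: ereal\<close>.\<close>

definition potential_mean :: "'a measure \<Rightarrow> (nat \<Rightarrow> 'a \<Rightarrow> real) \<Rightarrow> ereal" where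
  "potential_mean \<mu> f = lim (\<lambda>n. ereal ((\<integral>y. f n y \<partial>\<mu>) / real n))"


subsection \<open>Measures\<close>

definition borel_prob :: "'a::metric_space measure \<Rightarrow> bool" where
  "borel_prob \<mu> \<longleftrightarrow> prob_space \<mu> \<and> sets \<mu> = sets borel"

definition invariant_prob :: "('a \<Rightarrow> 'a) \<Rightarrow> 'a::metric_space measure \<Rightarrow> bool" where
  "invariant_prob S \<mu> \<longleftrightarrow>
     borel_prob \<mu> \<and> (\<forall>A \<in> sets borel. measure \<mu> (S -` A) = measure \<mu> A)"

definition ergodic_prob :: "('a \<Rightarrow> 'a) \<Rightarrow> 'a::metric_space measure \<Rightarrow> bool" where
  "ergodic_prob S \<mu> \<longleftrightarrow>
     invariant_prob S \<mu> \<and>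
     (\<forall>A \<in> sets borel. S -` A = A \<longrightarrow> measure \<mu> A = 0 \<or> measure \<mu> A = 1)"


subsection \<open>Covers\<close>

text \<open>
  Covers of a subset K of a space Z are covers of the topological space K with the subspace
  topology.  They are finite sets of sets and may contain the empty set.
\<close>

definition borel_subsets :: "'b topology \<Rightarrow> 'b set set" where
  "borel_subsets X = sigma_sets (topspace X) {U. openin X U}"

definition covers :: "'b topology \<Rightarrow> 'b set set set" where
  "covers X = {\<V>. finite \<V> \<and> \<V> \<subseteq> borel_subsets X \<and> \<Union>\<V> = topspace X}"

definition open_covers :: "'b topology \<Rightarrow> 'b set set set" where
  "open_covers X = {\<V> \<in> covers X. \<forall>V \<in> \<V>. openin X V}"

definition partitions :: "'b topology \<Rightarrow> 'b set set set" where
  "partitions X = {\<V> \<in> covers X. pairwise disjnt \<V>}"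

definition finer :: "'b set set \<Rightarrow> 'b set set \<Rightarrow> bool" where
  "finer \<V> \<W> \<longleftrightarrow> (\<forall>V \<in> \<V>. \<exists>W \<in> \<W>. V \<subseteq> W)"

definition cover_join :: "'b set set \<Rightarrow> 'b set set \<Rightarrow> 'b set set" where
  "cover_join \<U> \<V> = {U \<inter> V | U V. U \<in> \<U> \<and> V \<in> \<V>}"

text \<open>\<open>iterated_join S \<U> n\<close> is the join of the preimages of \<open>\<U>\<close> under S^j for j < n.\<close>

primrec iterated_join :: "('a \<Rightarrow> 'a) \<Rightarrow> 'a set set \<Rightarrow> nat \<Rightarrow> 'a set set" where
  "iterated_join S \<U> 0 = {UNIV}"
| "iterated_join S \<U> (Suc n) = cover_join (iterated_join S \<U> n) ((\<lambda>U. (S ^^ n) -` U) ` \<U>)"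

definition cover_power :: "'a set set \<Rightarrow> nat \<Rightarrow> (nat \<Rightarrow> 'a) set set" where
  "cover_power \<U> n = {Pi\<^sub>E {..<n} U | U. \<forall>i<n. U i \<in> \<U>}"


subsection \<open>Local entropy\<close>

definition partition_entropy :: "'a measure \<Rightarrow> 'a set set \<Rightarrow> real" where
  "partition_entropy \<mu> \<alpha> = - (\<Sum>A\<in>\<alpha>. measure \<mu> A * ln (measure \<mu> A))"

definition cover_entropy :: "'a::metric_space measure \<Rightarrow> 'a set set \<Rightarrow> real" where
  "cover_entropy \<mu> \<U> =
     Inf {partition_entropy \<mu> \<alpha> | \<alpha>. \<alpha> \<in> partitions euclidean \<and> finer \<alpha> \<U>}"

definition local_entropy :: "'a::metric_space measure \<Rightarrow> ('a \<Rightarrow> 'a) \<Rightarrow> 'a set set \<Rightarrow> real" where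
  "local_entropy \<mu> S \<U> = lim (\<lambda>n. cover_entropy \<mu> (iterated_join S \<U> n) / real n)"


subsection \<open>Pressure along average pseudo-orbits\<close>

text \<open>
  In the following definitions only n \<ge> 2 is meaningful; the other values do not affect the
  upper limit over n.
\<close>

definition avg_pseudo_orbits :: "('a::metric_space \<Rightarrow> 'a) \<Rightarrow> nat \<Rightarrow> real \<Rightarrow> (nat \<Rightarrow> 'a) set" where
  "avg_pseudo_orbits S n \<delta> =
     {x \<in> topspace (power_topology n).
        (\<Sum>i<n - 1. dist (S (x i)) (x (Suc i))) / real (n - 1) \<le> \<delta>}"

text \<open>For the empty set L the condition on averages is vacuous.\<close>

definition generic_pseudo_orbits ::
    "('a::metric_space \<Rightarrow> 'a) \<Rightarrow> nat \<Rightarrow> real \<Rightarrow> 'a measure \<Rightarrow> ('a \<Rightarrow> real) set \<Rightarrow> (nat \<Rightarrow> 'a) set" where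
  "generic_pseudo_orbits S n \<delta> \<mu> L =
     {x \<in> avg_pseudo_orbits S n \<delta>.
        \<forall>g\<in>L. \<bar>(\<Sum>i<n. g (x i)) / real n - (\<integral>y. g y \<partial>\<mu>)\<bar> \<le> \<delta>}"

text \<open>
  In \<^typ>\<open>ennreal\<close> the supremum over the empty set is 0, so empty members of a cover contribute 0.
  If K is empty, then the empty family is a cover of K and the infimum is 0.
\<close>

definition GP_n :: "('a::metric_space \<Rightarrow> 'a) \<Rightarrow> (nat \<Rightarrow> (nat \<Rightarrow> 'a) \<Rightarrow> real) \<Rightarrow> 'a set set \<Rightarrow>
    nat \<Rightarrow> real \<Rightarrow> 'a measure \<Rightarrow> ('a \<Rightarrow> real) set \<Rightarrow> ennreal" where
  "GP_n S F \<U> n \<delta> \<mu> L =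
     (let K = generic_pseudo_orbits S n \<delta> \<mu> L in
      INF \<V> \<in> {\<V> \<in> covers (subtopology (power_topology n) K). finer \<V> (cover_power \<U> n)}.
        \<Sum>V\<in>\<V>. SUP x\<in>V. ennreal (exp (F n x)))"

definition ext_log :: "ennreal \<Rightarrow> ereal" where
  "ext_log a = (if a = 0 then -\<infinity> else if a = \<infinity> then \<infinity> else ereal (ln (enn2real a)))"

definition GP_delta :: "('a::metric_space \<Rightarrow> 'a) \<Rightarrow> (nat \<Rightarrow> (nat \<Rightarrow> 'a) \<Rightarrow> real) \<Rightarrow> 'a set set \<Rightarrow>
    real \<Rightarrow> 'a measure \<Rightarrow> ('a \<Rightarrow> real) set \<Rightarrow> ereal" where
  "GP_delta S F \<U> \<delta> \<mu> L = limsup (\<lambda>n. ext_log (GP_n S F \<U> n \<delta> \<mu> L) / ereal (real n))"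

definition GP :: "('a::metric_space \<Rightarrow> 'a) \<Rightarrow> (nat \<Rightarrow> (nat \<Rightarrow> 'a) \<Rightarrow> real) \<Rightarrow> 'a set set \<Rightarrow>
    'a measure \<Rightarrow> ereal" where
  "GP S F \<U> \<mu> =
     (INF L \<in> {L. finite L \<and> (\<forall>g\<in>L. continuous_on UNIV g)}.
        INF \<delta> \<in> {0<..}. GP_delta S F \<U> \<delta> \<mu> L)"

end

theory Submission
  imports Defs
begin

text \<open>
  Upper bound. Fix a large N and a nearly optimal partition finer than the join of the preimages of
  \<open>\<U>\<close> under S^j for j < N. It defines a probability vector Q on words of length N over \<open>\<U>\<close>. The
  code length of a block z, that is the least value of -ln (Q w) over words w containing z, is upper
  semicontinuous, and its integral along true orbits is at most the entropy of the partition plus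
  ln 2. The potential of a block of length N is treated in the same way. An upper semicontinuous
  block function is dominated by a continuous function of the initial point with almost the same
  integral, plus a multiple of the distance of the block to the orbit of that point. Hence
  generic average pseudo-orbits have the expected average code length and the expected average
  potential. Cutting a pseudo-orbit into blocks at a good offset, Kraft's inequality bounds the
  number of words that are needed to cover all generic pseudo-orbits.

  Lower bound. By the ergodic theorem almost every true orbit is eventually generic, so a cover of
  the generic pseudo-orbits pulls back to a cover of a set of measure close to 1, to which Gibbs'
  inequality is applied. As only the integral of the potential enters, the sub-additive ergodic
  theorem is not needed.
\<close>

section \<open>Sub-additive sequences and entropy\<close>

text \<open>Average pseudo-orbits control only the mean jump: single blocks may stray far from every
  true orbit, and semicontinuity at true orbits says nothing about those. The proof therefore
  charges linearly for straying. Both the majorant of a block function and the drift of a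
  pseudo-orbit are affine in distances, so the errors, summed over all starting points, stay below a
  multiple of the total jump, which is at most \<open>\<delta> * n\<close>. Code length and
  potential are two block functions of the same kind, so each costs one test function and
  \<open>L\<close> has two elements. They use the offsets differently: the word count picks one
  favourable offset, whereas the potential is averaged over all offsets, so the two choices cannot
  conflict. In the lower bound the orbits that are not yet generic form a set whose measure tends to
  0 at an unknown speed. Logarithms of word counts grow linearly in \<open>n\<close>, and so does
  the upper bound of the potential, so this set contributes \<open>n\<close> times a null sequence,
  which disappears after division by \<open>n\<close>.\<close>

lemma subadditive_mult_le:
  fixes a :: "nat \<Rightarrow> real"
  assumes sub: "\<And>m n. a (m + n) \<le> a m + a n"
  shows "a (q * N + r) \<le> real q * a N + a r"
proof (induction q)
  case (Suc q)
  have "a (Suc q * N + r) \<le> a N + a (q * N + r)"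
    using sub[of N "q * N + r"] by (simp add: add.assoc)
  with Suc show ?case by (simp add: algebra_simps)
qed simp

text \<open>Division with remainder by a good \<open>N\<close> compares every \<open>a n / n\<close>
  with \<open>a N / N\<close> up to \<open>B / n\<close>. The limit is taken in the extended reals
  because the infimum may be \<open>-\<infinity>\<close>.\<close>

lemma fekete:
  fixes a :: "nat \<Rightarrow> real"
  assumes sub: "\<And>m n. a (m + n) \<le> a m + a n"
  shows "(\<lambda>n. ereal (a n / real n)) \<longlonglongrightarrow> (INF n\<in>{1..}. ereal (a n / real n))"
proof (rule order_tendstoI)
  fix c assume c: "c < (INF n\<in>{1..}. ereal (a n / real n))"
  have "c < ereal (a n / real n)" if "n \<ge> 1" for n
    using c that by (meson INF_lower atLeast_iff less_le_trans)
  then show "\<forall>\<^sub>F n in sequentially. c < ereal (a n / real n)"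
    by (auto simp: eventually_sequentially)
next
  fix c assume "(INF n\<in>{1..}. ereal (a n / real n)) < c"
  then obtain N where N: "N \<ge> 1" "ereal (a N / real N) < c"
    by (auto simp: INF_less_iff)
  then obtain b where b: "a N / real N < b" "ereal b < c"
    using ereal_dense2 less_ereal.simps(1) by blast
  \<comment> \<open>The first summand pays for the remainder \<open>a r\<close>, the second for
    replacing \<open>q\<close> by \<open>n / N\<close>.\<close>
  define B where "B = (\<Sum>r<N. \<bar>a r\<bar>) + \<bar>a N\<bar>"
  have bound: "a n / real n \<le> a N / real N + B / real n" if n: "n \<ge> 1" for n
  proof -
    define q r where "q = n div N" and "r = n mod N"
    have r: "r < N" and qr: "n = q * N + r"
      using N by (auto simp: q_def r_def)
    have "a r \<le> (\<Sum>r<N. \<bar>a r\<bar>)"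
      using member_le_sum[of r "{..<N}" "\<lambda>r. \<bar>a r\<bar>"] r by auto
    moreover have "a n \<le> real q * a N + a r"
      unfolding qr by (rule subadditive_mult_le[OF sub])
    moreover have "real q * a N = (real n - real r) * (a N / real N)"
      using N qr by (simp add: field_simps)
    moreover have "- real r * (a N / real N) \<le> \<bar>a N\<bar>"
    proof -
      have "- real r * (a N / real N) \<le> real r * (\<bar>a N\<bar> / real N)"
        using mult_left_mono[of "- a N" "\<bar>a N\<bar>" "real r / real N"] by (simp add: field_simps)
      also have "\<dots> \<le> real N * (\<bar>a N\<bar> / real N)"
        using r by (intro mult_right_mono) auto
      also have "\<dots> = \<bar>a N\<bar>" using N by simp
      finally show ?thesis .
    qed
    ultimately have "a n \<le> real n * (a N / real N) + B"
      by (simp add: B_def left_diff_distrib diff_divide_distrib)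
    then have "a n / real n \<le> (real n * (a N / real N) + B) / real n"
      by (rule divide_right_mono) simp
    then show ?thesis using n by (simp add: add_divide_distrib)
  qed
  have "(\<lambda>n. a N / real N + B / real n) \<longlonglongrightarrow> a N / real N + 0"
    by (intro tendsto_intros lim_const_over_n)
  then have "\<forall>\<^sub>F n in sequentially. a N / real N + B / real n < b"
    using b by (auto dest: order_tendstoD(2))
  then show "\<forall>\<^sub>F n in sequentially. ereal (a n / real n) < c"
    using eventually_ge_at_top[of 1]
  proof eventually_elim
    case (elim n)
    then have "ereal (a n / real n) < ereal b"
      using bound[of n] by simp
    then show ?case using b(2) by (rule less_trans)
  qed
qed

section \<open>Entropy inequalities and disjoint refinements\<close>

text \<open>This is \<open>ln t \<le> t - 1\<close> at the ratio of the two normalised weights,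
  summed against \<open>p\<close>. Neither weight has to be normalised, because the lower bound
  applies it to pieces of total mass less than 1. The last hypothesis keeps the default value of
  \<open>ln 0\<close> out of terms that count.\<close>

lemma gibbs_inequality:
  fixes p s :: "'i \<Rightarrow> real"
  assumes fin: "finite I" and p: "\<And>i. i \<in> I \<Longrightarrow> p i \<ge> 0" and s: "\<And>i. i \<in> I \<Longrightarrow> s i \<ge> 0"
    and ps: "\<And>i. i \<in> I \<Longrightarrow> p i > 0 \<Longrightarrow> s i > 0"
  shows "(\<Sum>i\<in>I. p i * (ln (s i) - ln (p i))) \<le> sum p I * ln (sum s I) - sum p I * ln (sum p I)"
proof (cases "sum p I = 0")
  case True
  then have "\<forall>i\<in>I. p i = 0" using fin p by (simp add: sum_nonneg_eq_0_iff)
  then show ?thesis by simp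
next
  case False
  define P Z where "P = sum p I" and "Z = sum s I"
  have P: "P > 0" using False p by (simp add: P_def less_le sum_nonneg)
  obtain i0 where i0: "i0 \<in> I" "p i0 > 0"
    using False p by (metis less_le sum.neutral)
  have Z: "Z > 0"
    unfolding Z_def using fin s ps i0 by (intro sum_pos2[of I i0]) auto
  have "p i * (ln (s i) - ln (p i)) - p i * (ln Z - ln P) \<le> s i * (P / Z) - p i" if i: "i \<in> I" for i
  proof (cases "p i = 0")
    case True then show ?thesis using s[OF i] P Z by simp
  next
    case False
    then have pi: "p i > 0" and si: "s i > 0" using p[OF i] ps[OF i] by auto
    have "ln (s i * P / (p i * Z)) \<le> s i * P / (p i * Z) - 1"
      using pi si P Z by (intro ln_le_minus_one) simp
    moreover have "ln (s i * P / (p i * Z)) = ln (s i) - ln (p i) - (ln Z - ln P)"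
      using pi si P Z by (simp add: ln_div ln_mult)
    ultimately have "p i * (ln (s i) - ln (p i) - (ln Z - ln P)) \<le> p i * (s i * P / (p i * Z) - 1)"
      using pi by (intro mult_left_mono) auto
    also have "\<dots> = s i * (P / Z) - p i" using pi Z by (simp add: field_simps)
    finally show ?thesis by (simp add: algebra_simps)
  qed
  then have "(\<Sum>i\<in>I. p i * (ln (s i) - ln (p i)) - p i * (ln Z - ln P)) \<le> (\<Sum>i\<in>I. s i * (P / Z) - p i)"
    by (rule sum_mono)
  also have "\<dots> = 0"
  proof -
    have "(\<Sum>i\<in>I. s i * (P / Z)) = Z * (P / Z)" by (simp only: Z_def sum_distrib_right)
    then show ?thesis using Z by (simp add: sum_subtractf P_def)
  qed
  finally have "(\<Sum>i\<in>I. p i * (ln (s i) - ln (p i))) - P * (ln Z - ln P) \<le> 0"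
    by (simp add: sum_subtractf P_def flip: sum_distrib_right)
  then show ?thesis by (simp add: P_def Z_def right_diff_distrib)
qed

text \<open>From \<open>ln t \<le> t - 1\<close> at \<open>t = 1 / x\<close>. The constant is crude,
  but it only enters as a bounded error that is later divided by \<open>n\<close>.\<close>

lemma neg_mult_ln_le_one: "- (x * ln x) \<le> (1::real)" if "x \<ge> 0" for x
proof (cases "x = 0")
  case False
  then have "- ln x \<le> 1 / x - 1"
    using that ln_le_minus_one[of "1/x"] by (simp add: ln_div)
  then have "x * (- ln x) \<le> x * (1 / x - 1)"
    using that by (intro mult_left_mono) auto
  also have "\<dots> \<le> 1" using that False by (simp add: field_simps)
  finally show ?thesis by simp
qed simp

text \<open>The family is indexed so that each piece remembers the set it was cut from, even when
  several \<open>B i\<close> coincide or pieces become empty.\<close>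

lemma finite_disjointification:
  fixes B :: "'i \<Rightarrow> 'a set"
  assumes "finite I" "\<And>i. i \<in> I \<Longrightarrow> B i \<in> sets M"
  shows "\<exists>D. (\<forall>i\<in>I. D i \<in> sets M \<and> D i \<subseteq> B i) \<and> disjoint_family_on D I \<and>
    (\<Union>i\<in>I. D i) = (\<Union>i\<in>I. B i)"
  using assms
proof (induction I rule: finite_induct)
    case empty then show ?case by (simp add: disjoint_family_on_def)
  next
    case (insert j I)
    then obtain D where D: "\<forall>i\<in>I. D i \<in> sets M \<and> D i \<subseteq> B i" "disjoint_family_on D I"
      "(\<Union>i\<in>I. D i) = (\<Union>i\<in>I. B i)" by auto
    define D' where "D' = D(j := B j - (\<Union>i\<in>I. B i))"
    have D': "D' i = D i" if "i \<in> I" for i using that insert.hyps by (auto simp: D'_def)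
    have "D' i \<in> sets M \<and> D' i \<subseteq> B i" if "i \<in> insert j I" for i
    proof (cases "i = j")
      case True
      have "(\<Union>i\<in>I. B i) \<in> sets M"
        using insert.hyps(1) insert.prems by (intro sets.finite_UN) auto
      then show ?thesis using True insert.prems by (simp add: D'_def sets.Diff)
    next
      case False
      then show ?thesis using that D(1) by (simp add: D'_def)
    qed
    moreover have "disjoint_family_on D' (insert j I)"
    proof -
      have "D' j \<inter> D' i = {}" if "i \<in> I" for i
        using that D(1) D'[OF that] by (auto simp: D'_def)
      moreover have "disjoint_family_on D' I"
        using D(2) D' by (auto simp: disjoint_family_on_def)
      ultimately show ?thesis
        using insert.hyps by (auto simp: disjoint_family_on_insert)
    qed
    moreover have "(\<Union>i\<in>insert j I. D' i) = (\<Union>i\<in>insert j I. B i)"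
    proof -
      have "(\<Union>i\<in>I. D' i) = (\<Union>i\<in>I. B i)" using D(3) D' by auto
      moreover have "D' j = B j - (\<Union>i\<in>I. B i)" by (simp add: D'_def)
      ultimately show ?thesis by auto
    qed
    ultimately show ?case by (intro exI[of _ D'] conjI ballI) simp_all
qed

section \<open>Itineraries and the entropy of covers\<close>

text \<open>The cylinder of a word. Words serve as common names: the same \<open>w\<close> denotes a
  member of the iterated join here and a box in the power space later.\<close>

definition itinerary :: "('a \<Rightarrow> 'a) \<Rightarrow> nat \<Rightarrow> (nat \<Rightarrow> 'a set) \<Rightarrow> 'a set" where
  "itinerary S n w = {y. \<forall>l<n. (S ^^ l) y \<in> w l}"

lemma itinerary_cong: "(\<And>l. l < n \<Longrightarrow> w l = v l) \<Longrightarrow> itinerary S n w = itinerary S n v"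
  by (simp add: itinerary_def)

lemma itinerary_Suc: "itinerary S (Suc n) w = itinerary S n w \<inter> (S ^^ n) -` w n"
  by (auto simp: itinerary_def less_Suc_eq)

lemma iterated_join_eq: "iterated_join S \<U> n = itinerary S n ` ({..<n} \<rightarrow>\<^sub>E \<U>)"
proof (induction n)
  case 0 show ?case by (simp add: itinerary_def)
next
  case (Suc n)
  show ?case
  proof (intro set_eqI iffI)
    fix X assume "X \<in> iterated_join S \<U> (Suc n)"
    then obtain w U where w: "w \<in> {..<n} \<rightarrow>\<^sub>E \<U>" "U \<in> \<U>" "X = itinerary S n w \<inter> (S ^^ n) -` U"
      by (auto simp: Suc cover_join_def)
    have "X = itinerary S (Suc n) (w(n := U))"
      unfolding itinerary_Suc w(3) by (simp cong: itinerary_cong)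
    moreover have "w(n := U) \<in> {..<Suc n} \<rightarrow>\<^sub>E \<U>"
      using w by (auto simp: PiE_iff extensional_def less_Suc_eq)
    ultimately show "X \<in> itinerary S (Suc n) ` ({..<Suc n} \<rightarrow>\<^sub>E \<U>)" by blast
  next
    fix X assume "X \<in> itinerary S (Suc n) ` ({..<Suc n} \<rightarrow>\<^sub>E \<U>)"
    then obtain w where w: "w \<in> {..<Suc n} \<rightarrow>\<^sub>E \<U>" "X = itinerary S (Suc n) w" by blast
    have "X = itinerary S n (restrict w {..<n}) \<inter> (S ^^ n) -` w n"
      unfolding w(2) itinerary_Suc by (simp cong: itinerary_cong)
    moreover have "restrict w {..<n} \<in> {..<n} \<rightarrow>\<^sub>E \<U>" "w n \<in> \<U>" using w(1) by auto
    ultimately show "X \<in> iterated_join S \<U> (Suc n)"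
      unfolding iterated_join.simps Suc cover_join_def by blast
  qed
qed

lemma borel_subsets_euclidean: "borel_subsets euclidean = sets borel"
  by (simp add: borel_subsets_def borel_def sets_measure_of)

lemma covers_euclidean_iff: "\<W> \<in> covers euclidean \<longleftrightarrow> finite \<W> \<and> \<W> \<subseteq> sets borel \<and> \<Union>\<W> = UNIV"
  by (simp add: covers_def borel_subsets_euclidean)

lemma partitions_euclidean_iff:
  "\<alpha> \<in> partitions euclidean \<longleftrightarrow> finite \<alpha> \<and> \<alpha> \<subseteq> sets borel \<and> \<Union>\<alpha> = UNIV \<and> pairwise disjnt \<alpha>"
  by (auto simp: partitions_def covers_euclidean_iff)

locale invariant_system =
  fixes S :: "'a::metric_space \<Rightarrow> 'a" and \<mu> :: "'a measure"
  assumes tds: "tds S" and invariant: "invariant_prob S \<mu>"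
begin

lemma sets_eq_borel [simp, measurable_cong]: "sets \<mu> = sets borel"
  using invariant by (simp add: invariant_prob_def borel_prob_def)

lemma space_eq_UNIV [simp]: "space \<mu> = UNIV"
  using sets_eq_imp_space_eq[OF sets_eq_borel] by simp

sublocale prob_space \<mu>
  using invariant by (simp add: invariant_prob_def borel_prob_def)

lemma compact_UNIV: "compact (UNIV :: 'a set)"
  using tds by (simp add: tds_def)

lemma continuous_iterate: "continuous_on UNIV (S ^^ i)"
proof (induction i)
  case (Suc i)
  then show ?case
    using tds unfolding tds_def
    by (metis continuous_on_compose continuous_on_subset funpow.simps(2) subset_UNIV)
qed (simp add: id_def)

lemma measurable_iterate [measurable]: "S ^^ i \<in> borel_measurable borel"
  by (rule borel_measurable_continuous_onI[OF continuous_iterate])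

lemma vimage_iterate_borel: "A \<in> sets borel \<Longrightarrow> (S ^^ i) -` A \<in> sets borel"
  using measurable_sets[OF measurable_iterate, of A i] by simp

lemma prob_vimage_iterate: "A \<in> sets borel \<Longrightarrow> prob ((S ^^ i) -` A) = prob A"
proof (induction i arbitrary: A)
  case (Suc i)
  have "(S ^^ Suc i) -` A = S -` ((S ^^ i) -` A)"
    by (simp only: funpow_Suc_right vimage_comp)
  then have "prob ((S ^^ Suc i) -` A) = prob (S -` ((S ^^ i) -` A))" by simp
  also have "\<dots> = prob ((S ^^ i) -` A)"
    using invariant vimage_iterate_borel[OF Suc.prems] by (simp add: invariant_prob_def)
  also have "\<dots> = prob A" by (rule Suc.IH[OF Suc.prems])
  finally show ?case .
qed simp

lemma distr_iterate: "distr \<mu> borel (S ^^ i) = \<mu>"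
proof (rule measure_eqI)
  fix A assume "A \<in> sets (distr \<mu> borel (S ^^ i))"
  then have A: "A \<in> sets borel" by simp
  have "emeasure (distr \<mu> borel (S ^^ i)) A = emeasure \<mu> ((S ^^ i) -` A)"
    using A by (subst emeasure_distr) auto
  then show "emeasure (distr \<mu> borel (S ^^ i)) A = emeasure \<mu> A"
    using prob_vimage_iterate[OF A, of i] by (simp add: emeasure_eq_measure)
qed simp

lemma integral_iterate:
  fixes g :: "'a \<Rightarrow> real"
  assumes [measurable]: "g \<in> borel_measurable borel"
  shows "(\<integral>y. g ((S ^^ i) y) \<partial>\<mu>) = (\<integral>y. g y \<partial>\<mu>)"
proof -
  have "(\<integral>y. g y \<partial>\<mu>) = (\<integral>y. g y \<partial>(distr \<mu> borel (S ^^ i)))" by (simp only: distr_iterate)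
  also have "\<dots> = (\<integral>y. g ((S ^^ i) y) \<partial>\<mu>)" by (rule integral_distr) auto
  finally show ?thesis ..
qed

lemma continuous_bounded:
  fixes g :: "'a \<Rightarrow> real"
  assumes "continuous_on UNIV g"
  obtains B where "B \<ge> 0" "\<And>y. \<bar>g y\<bar> \<le> B"
proof -
  have "bounded (g ` UNIV)"
    using assms compact_UNIV compact_continuous_image compact_imp_bounded by blast
  then obtain B where "\<forall>y. \<bar>g y\<bar> \<le> B" by (auto simp: bounded_iff)
  then show ?thesis using that[of B] abs_ge_zero order_trans by blast
qed

lemma integrable_continuous:
  fixes g :: "'a \<Rightarrow> real"
  assumes "continuous_on UNIV g"
  shows "integrable \<mu> g"
proof -
  have [measurable]: "g \<in> borel_measurable borel" using assms by (rule borel_measurable_continuous_onI)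
  obtain B where "\<And>y. \<bar>g y\<bar> \<le> B" using continuous_bounded[OF assms] by metis
  then show ?thesis by (intro integrable_const_bound[where B = B]) auto
qed

lemma partition_entropy_nonneg: "partition_entropy \<mu> \<alpha> \<ge> 0"
proof -
  have "prob A * ln (prob A) \<le> 0" for A
    by (cases "prob A = 0") (auto simp: mult_nonneg_nonpos zero_less_measure_iff)
  then show ?thesis by (simp add: partition_entropy_def sum_nonpos)
qed

lemma cover_entropy_le:
  assumes "\<alpha> \<in> partitions euclidean" "finer \<alpha> \<W>"
  shows "cover_entropy \<mu> \<W> \<le> partition_entropy \<mu> \<alpha>"
  unfolding cover_entropy_def
proof (rule cInf_lower)
  show "bdd_below {partition_entropy \<mu> \<alpha> |\<alpha>. \<alpha> \<in> partitions euclidean \<and> finer \<alpha> \<W>}"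
    using partition_entropy_nonneg by (intro bdd_belowI[of _ 0]) auto
qed (use assms in auto)

text \<open>By disjointness, two indices can share a piece only if it is empty, and then it
  contributes 0, so the indexed sum equals the sum over the partition. Index sets that are products
  or disjoint sums can thus be used directly.\<close>

lemma cover_entropy_le_indexed:
  assumes fin: "finite I" and D: "\<And>i. i \<in> I \<Longrightarrow> D i \<in> sets borel" "disjoint_family_on D I"
    "(\<Union>i\<in>I. D i) = UNIV" and sub: "\<And>i. i \<in> I \<Longrightarrow> \<exists>W\<in>\<W>. D i \<subseteq> W"
  shows "cover_entropy \<mu> \<W> \<le> (\<Sum>i\<in>I. - (prob (D i) * ln (prob (D i))))"
proof -
  have "D ` I \<in> partitions euclidean"
    using fin D by (auto simp: partitions_euclidean_iff intro: disjoint_family_on_disjoint_image)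
  moreover have "finer (D ` I) \<W>" using sub by (auto simp: finer_def)
  ultimately have "cover_entropy \<mu> \<W> \<le> partition_entropy \<mu> (D ` I)" by (rule cover_entropy_le)
  also have "(\<Sum>A\<in>D ` I. prob A * ln (prob A)) = sum ((\<lambda>A. prob A * ln (prob A)) \<circ> D) I"
  proof (rule sum.reindex_nontrivial[OF fin])
    fix i j assume "i \<in> I" "j \<in> I" "i \<noteq> j" "D i = D j"
    then have "D i = {}" using D(2) by (auto simp: disjoint_family_on_def)
    then show "prob (D i) * ln (prob (D i)) = 0" by simp
  qed
  then have "partition_entropy \<mu> (D ` I) = (\<Sum>i\<in>I. - (prob (D i) * ln (prob (D i))))"
    by (simp add: partition_entropy_def sum_negf)
  finally show ?thesis .
qed

text \<open>Makes the set under the infimum in \<open>cover_entropy\<close> nonempty; a real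
  \<open>Inf\<close> over the empty set would carry no information.\<close>

lemma finer_partition_exists:
  assumes "\<W> \<in> covers euclidean"
  obtains \<alpha> where "\<alpha> \<in> partitions euclidean" "finer \<alpha> \<W>"
proof -
  from assms have W: "finite \<W>" "\<And>W. W \<in> \<W> \<Longrightarrow> W \<in> sets borel" "\<Union>\<W> = UNIV"
    by (auto simp: covers_euclidean_iff)
  obtain D where D: "\<forall>W\<in>\<W>. D W \<in> sets borel \<and> D W \<subseteq> W"
    "disjoint_family_on D \<W>" "(\<Union>W\<in>\<W>. D W) = (\<Union>W\<in>\<W>. W)"
    using finite_disjointification[of \<W> "\<lambda>W. W" borel] W by auto
  have "D ` \<W> \<in> partitions euclidean"
    using W D by (auto simp: partitions_euclidean_iff intro: disjoint_family_on_disjoint_image)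
  moreover have "finer (D ` \<W>) \<W>" using D(1) by (auto simp: finer_def)
  ultimately show ?thesis by (rule that)
qed

lemma cover_entropy_approx:
  assumes "\<W> \<in> covers euclidean" "\<epsilon> > 0"
  obtains \<alpha> where "\<alpha> \<in> partitions euclidean" "finer \<alpha> \<W>"
    "partition_entropy \<mu> \<alpha> < cover_entropy \<mu> \<W> + \<epsilon>"
proof -
  define X where "X = {\<alpha>. \<alpha> \<in> partitions euclidean \<and> finer \<alpha> \<W>}"
  have eq: "cover_entropy \<mu> \<W> = Inf (partition_entropy \<mu> ` X)"
    unfolding cover_entropy_def X_def by (rule arg_cong[where f = Inf]) auto
  obtain \<alpha> where "\<alpha> \<in> partitions euclidean" "finer \<alpha> \<W>"
    using finer_partition_exists[OF assms(1)] .
  then have "partition_entropy \<mu> ` X \<noteq> {}" by (auto simp: X_def)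
  moreover have "Inf (partition_entropy \<mu> ` X) < cover_entropy \<mu> \<W> + \<epsilon>"
    using assms(2) by (simp add: eq)
  ultimately obtain \<beta> where "\<beta> \<in> X" "partition_entropy \<mu> \<beta> < cover_entropy \<mu> \<W> + \<epsilon>"
    using cInf_lessD by (metis (no_types, lifting) imageE)
  then show ?thesis by (intro that[of \<beta>]) (simp_all add: X_def)
qed

lemma cover_entropy_nonneg:
  assumes "\<W> \<in> covers euclidean"
  shows "cover_entropy \<mu> \<W> \<ge> 0"
proof -
  obtain \<alpha> where "\<alpha> \<in> partitions euclidean" "finer \<alpha> \<W>"
    using finer_partition_exists[OF assms] .
  then have "{partition_entropy \<mu> \<alpha> |\<alpha>. \<alpha> \<in> partitions euclidean \<and> finer \<alpha> \<W>} \<noteq> {}"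
    by auto
  then show ?thesis
    unfolding cover_entropy_def by (rule cInf_greatest) (auto simp: partition_entropy_nonneg)
qed

lemma sum_prob_Int:
  assumes "finite J" "\<And>j. j \<in> J \<Longrightarrow> B j \<in> sets borel" "disjoint_family_on B J" "(\<Union>j\<in>J. B j) = UNIV"
    "A \<in> sets borel"
  shows "(\<Sum>j\<in>J. prob (A \<inter> B j)) = prob A"
proof -
  have "prob (\<Union>j\<in>J. A \<inter> B j) = (\<Sum>j\<in>J. prob (A \<inter> B j))"
    using assms by (intro finite_measure_finite_Union) (auto simp: disjoint_family_on_def)
  moreover have "(\<Union>j\<in>J. A \<inter> B j) = A" using assms(4) by auto
  ultimately show ?thesis by simp
qed

text \<open>Gibbs' inequality for the joint distribution against the product of its marginals, both
  of total mass 1. Where the joint mass is positive so are both marginals, hence the logarithm of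
  the product splits; the other terms vanish.\<close>

lemma entropy_join_le:
  assumes A: "finite I" "\<And>i. i \<in> I \<Longrightarrow> A i \<in> sets borel" "disjoint_family_on A I" "(\<Union>i\<in>I. A i) = UNIV"
    and B: "finite J" "\<And>j. j \<in> J \<Longrightarrow> B j \<in> sets borel" "disjoint_family_on B J" "(\<Union>j\<in>J. B j) = UNIV"
  shows "(\<Sum>(i, j)\<in>I \<times> J. - (prob (A i \<inter> B j) * ln (prob (A i \<inter> B j))))
    \<le> (\<Sum>i\<in>I. - (prob (A i) * ln (prob (A i)))) + (\<Sum>j\<in>J. - (prob (B j) * ln (prob (B j))))"
proof -
  define p s where "p = (\<lambda>(i, j). prob (A i \<inter> B j))" and "s = (\<lambda>(i, j). prob (A i) * prob (B j))"
  have sumA: "(\<Sum>i\<in>I. prob (A i)) = 1" and sumB: "(\<Sum>j\<in>J. prob (B j)) = 1"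
    using sum_prob_Int[OF A, of UNIV] sum_prob_Int[OF B, of UNIV] prob_space by simp_all
  have pA: "(\<Sum>j\<in>J. prob (A i \<inter> B j)) = prob (A i)" if "i \<in> I" for i
    using sum_prob_Int[OF B A(2)[OF that]] .
  have pB: "(\<Sum>i\<in>I. prob (A i \<inter> B j)) = prob (B j)" if "j \<in> J" for j
    using sum_prob_Int[OF A B(2)[OF that]] by (simp add: Int_commute)
  have sp: "sum p (I \<times> J) = 1"
    using sumA by (simp add: p_def sum.cartesian_product[symmetric] pA)
  have ss: "sum s (I \<times> J) = 1"
    by (simp add: s_def sum.cartesian_product[symmetric] sumB sumA flip: sum_distrib_left)
  have pos: "prob (A i) > 0 \<and> prob (B j) > 0" if "i \<in> I" "j \<in> J" "p (i, j) > 0" for i j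
  proof -
    have "p (i, j) \<le> prob (A i)" "p (i, j) \<le> prob (B j)"
      unfolding p_def using A(2) B(2) that by (auto intro!: finite_measure_mono)
    then show ?thesis using that(3) by linarith
  qed
  have "(\<Sum>x\<in>I \<times> J. p x * (ln (s x) - ln (p x))) \<le> 1 * ln 1 - 1 * ln 1"
  proof -
    have "(\<Sum>x\<in>I \<times> J. p x * (ln (s x) - ln (p x)))
        \<le> sum p (I \<times> J) * ln (sum s (I \<times> J)) - sum p (I \<times> J) * ln (sum p (I \<times> J))"
      by (rule gibbs_inequality) (use A(1) B(1) pos in \<open>auto simp: p_def s_def\<close>)
    then show ?thesis using sp ss by simp
  qed
  then have "(\<Sum>x\<in>I \<times> J. - (p x * ln (p x))) \<le> (\<Sum>x\<in>I \<times> J. - (p x * ln (s x)))"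
    by (simp add: right_diff_distrib sum_subtractf sum_negf)
  also have "\<dots> = (\<Sum>(i, j)\<in>I \<times> J. - (prob (A i \<inter> B j) * ln (prob (A i)))
      - prob (A i \<inter> B j) * ln (prob (B j)))"
  proof (rule sum.cong[OF refl], clarify)
    fix i j assume "i \<in> I" "j \<in> J"
    then show "- (p (i, j) * ln (s (i, j))) = - (prob (A i \<inter> B j) * ln (prob (A i)))
      - prob (A i \<inter> B j) * ln (prob (B j))"
      using pos[of i j] by (cases "p (i, j) = 0")
        (auto simp: p_def s_def ln_mult algebra_simps zero_less_measure_iff)
  qed
  also have "\<dots> = (\<Sum>i\<in>I. \<Sum>j\<in>J. - (prob (A i \<inter> B j) * ln (prob (A i))))
      + (\<Sum>i\<in>I. \<Sum>j\<in>J. - (prob (A i \<inter> B j) * ln (prob (B j))))"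
    by (simp add: sum.cartesian_product[symmetric] sum.distrib[symmetric])
  also have "(\<Sum>i\<in>I. \<Sum>j\<in>J. - (prob (A i \<inter> B j) * ln (prob (A i)))) =
      (\<Sum>i\<in>I. - (prob (A i) * ln (prob (A i))))"
    by (intro sum.cong refl) (simp add: sum_negf pA flip: sum_distrib_right)
  also have "(\<Sum>i\<in>I. \<Sum>j\<in>J. - (prob (A i \<inter> B j) * ln (prob (B j)))) =
      (\<Sum>j\<in>J. - (prob (B j) * ln (prob (B j))))"
    by (subst sum.swap, intro sum.cong refl) (simp add: sum_negf pB flip: sum_distrib_right)
  finally show ?thesis by (simp add: p_def case_prod_unfold)
qed

lemma iterated_join_covers:
  assumes "\<U> \<in> covers euclidean"
  shows "iterated_join S \<U> n \<in> covers euclidean"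
  unfolding covers_euclidean_iff
proof (intro conjI)
  have U: "finite \<U>" "\<U> \<subseteq> sets borel" "\<Union>\<U> = UNIV" using assms by (auto simp: covers_euclidean_iff)
  show "finite (iterated_join S \<U> n)"
    unfolding iterated_join_eq using U(1) by (simp add: finite_PiE)
  show "iterated_join S \<U> n \<subseteq> sets borel"
  proof (induction n)
    case (Suc n)
    have "U \<inter> V \<in> sets borel"
      if "U \<in> iterated_join S \<U> n" "V \<in> (\<lambda>U. (S ^^ n) -` U) ` \<U>" for U V
      using that Suc U(2) vimage_iterate_borel by (intro sets.Int) auto
    then show ?case unfolding iterated_join.simps cover_join_def by auto
  qed simp
  show "\<Union>(iterated_join S \<U> n) = UNIV"
  proof (induction n)
    case (Suc n)
    have "\<Union>(cover_join \<A> \<B>) = \<Union>\<A> \<inter> \<Union>\<B>" for \<A> \<B> :: "'a set set"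
      unfolding cover_join_def by blast
    moreover have "\<Union>((\<lambda>U. (S ^^ n) -` U) ` \<U>) = (S ^^ n) -` \<Union>\<U>" by blast
    ultimately show ?case using Suc U(3) by simp
  qed simp
qed

lemma itinerary_add:
  "itinerary S (m + n) w = itinerary S m w \<inter> (S ^^ m) -` itinerary S n (\<lambda>l. w (m + l))"
proof -
  have "(\<forall>l<m + n. (S ^^ l) y \<in> w l) \<longleftrightarrow>
      (\<forall>l<m. (S ^^ l) y \<in> w l) \<and> (\<forall>l<n. (S ^^ (m + l)) y \<in> w (m + l))" for y
  proof (intro iffI conjI allI impI)
    fix l assume *: "(\<forall>l<m. (S ^^ l) y \<in> w l) \<and> (\<forall>l<n. (S ^^ (m + l)) y \<in> w (m + l))" and l: "l < m + n"
    show "(S ^^ l) y \<in> w l"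
    proof (cases "l < m")
      case False
      then obtain k where "l = m + k" by (metis le_add_diff_inverse not_less)
      then show ?thesis using * l by auto
    qed (use * in auto)
  qed auto
  moreover have "(S ^^ (m + l)) y = (S ^^ l) ((S ^^ m) y)" for l y
    by (subst add.commute) (simp add: funpow_add)
  ultimately show ?thesis by (auto simp: itinerary_def)
qed

text \<open>Join a nearly optimal partition for the first \<open>m\<close> steps with the pull-back
  under \<open>S ^^ m\<close> of one for the next \<open>n\<close> steps. Concatenated words show
  that the join is fine enough, and invariance makes the pull-back cost no more entropy than the
  original.\<close>

lemma cover_entropy_iterated_join_subadditive:
  assumes "\<U> \<in> covers euclidean"
  shows "cover_entropy \<mu> (iterated_join S \<U> (m + n)) \<le>
    cover_entropy \<mu> (iterated_join S \<U> m) + cover_entropy \<mu> (iterated_join S \<U> n)"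
proof (rule field_le_epsilon)
  fix \<epsilon> :: real assume "\<epsilon> > 0"
  then have \<epsilon>: "\<epsilon> / 2 > 0" by simp
  obtain \<alpha> where \<alpha>: "\<alpha> \<in> partitions euclidean" "finer \<alpha> (iterated_join S \<U> m)"
    "partition_entropy \<mu> \<alpha> < cover_entropy \<mu> (iterated_join S \<U> m) + \<epsilon> / 2"
    using cover_entropy_approx[OF iterated_join_covers[OF assms] \<epsilon>] by metis
  obtain \<beta> where \<beta>: "\<beta> \<in> partitions euclidean" "finer \<beta> (iterated_join S \<U> n)"
    "partition_entropy \<mu> \<beta> < cover_entropy \<mu> (iterated_join S \<U> n) + \<epsilon> / 2"
    using cover_entropy_approx[OF iterated_join_covers[OF assms] \<epsilon>] by metis
  have A: "finite \<alpha>" "\<And>A. A \<in> \<alpha> \<Longrightarrow> A \<in> sets borel" "disjoint_family_on (\<lambda>A. A) \<alpha>" "(\<Union>A\<in>\<alpha>. A) = UNIV"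
    using \<alpha>(1) by (auto simp: partitions_euclidean_iff disjoint_family_on_def pairwise_def disjnt_def)
  have "(S ^^ m) -` B \<inter> (S ^^ m) -` B' = {}" if "B \<in> \<beta>" "B' \<in> \<beta>" "B \<noteq> B'" for B B'
  proof -
    have "B \<inter> B' = {}"
      using that \<beta>(1) by (auto simp: partitions_euclidean_iff pairwise_def disjnt_def)
    then show ?thesis by (simp flip: vimage_Int)
  qed
  moreover have "\<Union>\<beta> = UNIV" "finite \<beta>" "\<beta> \<subseteq> sets borel"
    using \<beta>(1) by (auto simp: partitions_euclidean_iff)
  ultimately have B: "finite \<beta>" "\<And>B. B \<in> \<beta> \<Longrightarrow> (S ^^ m) -` B \<in> sets borel"
    "disjoint_family_on (\<lambda>B. (S ^^ m) -` B) \<beta>" "(\<Union>B\<in>\<beta>. (S ^^ m) -` B) = UNIV"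
    using vimage_iterate_borel by (auto simp: disjoint_family_on_def simp flip: vimage_Union)
  have "cover_entropy \<mu> (iterated_join S \<U> (m + n)) \<le>
     (\<Sum>x\<in>\<alpha> \<times> \<beta>. - (prob (fst x \<inter> (S ^^ m) -` snd x) * ln (prob (fst x \<inter> (S ^^ m) -` snd x))))"
  proof (rule cover_entropy_le_indexed)
    show "disjoint_family_on (\<lambda>x. fst x \<inter> (S ^^ m) -` snd x) (\<alpha> \<times> \<beta>)"
      unfolding disjoint_family_on_def
    proof (intro ballI impI)
      fix x y assume xy: "x \<in> \<alpha> \<times> \<beta>" "y \<in> \<alpha> \<times> \<beta>" "x \<noteq> y"
      then consider "fst x \<noteq> fst y" | "snd x \<noteq> snd y" by (auto simp: prod_eq_iff)
      then show "fst x \<inter> (S ^^ m) -` snd x \<inter> (fst y \<inter> (S ^^ m) -` snd y) = {}"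
      proof cases
        case 1
        then have "fst x \<inter> fst y = {}"
          using xy disjoint_family_onD[OF A(3), of "fst x" "fst y"] by (simp add: mem_Times_iff)
        then show ?thesis by auto
      next
        case 2
        then have "(S ^^ m) -` snd x \<inter> (S ^^ m) -` snd y = {}"
          using xy disjoint_family_onD[OF B(3), of "snd x" "snd y"] by (simp add: mem_Times_iff)
        then show ?thesis by auto
      qed
    qed
    show "(\<Union>x\<in>\<alpha> \<times> \<beta>. fst x \<inter> (S ^^ m) -` snd x) = UNIV"
      using A(4) B(4) by (simp add: set_eq_iff)
    fix x assume x: "x \<in> \<alpha> \<times> \<beta>"
    then have fs: "fst x \<in> \<alpha>" "snd x \<in> \<beta>" by auto
    show "fst x \<inter> (S ^^ m) -` snd x \<in> sets borel"
      by (intro sets.Int A(2) B(2) fs)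
    have "\<exists>u\<in>{..<m} \<rightarrow>\<^sub>E \<U>. fst x \<subseteq> itinerary S m u"
      using \<alpha>(2) fs(1) by (simp add: finer_def iterated_join_eq)
    then obtain u where u: "u \<in> {..<m} \<rightarrow>\<^sub>E \<U>" "fst x \<subseteq> itinerary S m u" by blast
    have "\<exists>v\<in>{..<n} \<rightarrow>\<^sub>E \<U>. snd x \<subseteq> itinerary S n v"
      using \<beta>(2) fs(2) by (simp add: finer_def iterated_join_eq)
    then obtain v where v: "v \<in> {..<n} \<rightarrow>\<^sub>E \<U>" "snd x \<subseteq> itinerary S n v" by blast
    define w where "w = (\<lambda>i\<in>{..<m + n}. if i < m then u i else v (i - m))"
    have "itinerary S (m + n) w = itinerary S m u \<inter> (S ^^ m) -` itinerary S n v"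
      unfolding itinerary_add by (simp add: w_def cong: itinerary_cong)
    then have "fst x \<inter> (S ^^ m) -` snd x \<subseteq> itinerary S (m + n) w" using u(2) v(2) by auto
    moreover have "w \<in> {..<m + n} \<rightarrow>\<^sub>E \<U>" using u(1) v(1) by (auto simp: w_def PiE_iff)
    ultimately show "\<exists>W\<in>iterated_join S \<U> (m + n). fst x \<inter> (S ^^ m) -` snd x \<subseteq> W"
      by (auto simp: iterated_join_eq)
  qed (use A B in auto)
  also have "\<dots> \<le> (\<Sum>A\<in>\<alpha>. - (prob A * ln (prob A)))
      + (\<Sum>B\<in>\<beta>. - (prob ((S ^^ m) -` B) * ln (prob ((S ^^ m) -` B))))"
    using entropy_join_le[OF A B] by (simp add: case_prod_unfold)
  also have "(\<Sum>B\<in>\<beta>. - (prob ((S ^^ m) -` B) * ln (prob ((S ^^ m) -` B)))) = partition_entropy \<mu> \<beta>"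
    unfolding partition_entropy_def sum_negf[symmetric] using \<beta>(1)
    by (intro sum.cong refl) (auto simp: partitions_euclidean_iff prob_vimage_iterate)
  also have "(\<Sum>A\<in>\<alpha>. - (prob A * ln (prob A))) = partition_entropy \<mu> \<alpha>"
    by (simp add: partition_entropy_def sum_negf)
  finally show "cover_entropy \<mu> (iterated_join S \<U> (m + n)) \<le>
    cover_entropy \<mu> (iterated_join S \<U> m) + cover_entropy \<mu> (iterated_join S \<U> n) + \<epsilon>"
    using \<alpha>(3) \<beta>(3) by simp
qed

text \<open>\<open>lim\<close> is informative only once convergence is known. The limit from
  \<open>fekete\<close> is real since it lies between 0 and the term for
  \<open>n = 1\<close>.\<close>

lemma local_entropy_tendsto:
  assumes "\<U> \<in> covers euclidean"
  shows "(\<lambda>n. cover_entropy \<mu> (iterated_join S \<U> n) / real n) \<longlonglongrightarrow> local_entropy \<mu> S \<U>"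
proof -
  let ?a = "\<lambda>n. cover_entropy \<mu> (iterated_join S \<U> n)"
  let ?L = "INF n\<in>{1..}. ereal (?a n / real n)"
  have lim: "(\<lambda>n. ereal (?a n / real n)) \<longlonglongrightarrow> ?L"
    by (rule fekete[OF cover_entropy_iterated_join_subadditive[OF assms]])
  have "0 \<le> ?L"
    using cover_entropy_nonneg[OF iterated_join_covers[OF assms]] by (intro INF_greatest) simp
  moreover have "?L \<le> ereal (?a 1 / real 1)" by (rule INF_lower) simp
  ultimately have "\<bar>?L\<bar> \<noteq> \<infinity>" by auto
  then obtain l where "?L = ereal l" by auto
  with lim have "(\<lambda>n. ?a n / real n) \<longlonglongrightarrow> l" by simp
  then show ?thesis unfolding local_entropy_def by (simp add: limI)
qed

end

section \<open>Block potentials and drift of pseudo-orbits\<close>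

lemma topspace_power_topology [simp]: "topspace (power_topology n) = {..<n} \<rightarrow>\<^sub>E UNIV"
  by (simp add: power_topology_def)

text \<open>
  The value at n = 0 is set to 0, as F 0 is unconstrained; sub-additivity then also holds for empty
  blocks. The argument need not be extensional, which makes shifts easy to write.
\<close>

definition block_potential :: "(nat \<Rightarrow> (nat \<Rightarrow> 'a) \<Rightarrow> real) \<Rightarrow> nat \<Rightarrow> (nat \<Rightarrow> 'a) \<Rightarrow> real" where
  "block_potential F n x = (if n = 0 then 0 else F n (restrict x {..<n}))"

lemma block_potential_add:
  assumes "block_subadditive F"
  shows "block_potential F (n + m) x \<le> block_potential F n x + block_potential F m (\<lambda>i. x (n + i))"
proof (cases "n = 0 \<or> m = 0")
  case False
  then have nm: "n \<ge> 1" "m \<ge> 1" by auto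
  let ?x = "restrict x {..<n + m}"
  have "F (n + m) ?x \<le> F n (\<lambda>i\<in>{..<n}. ?x i) + F m (\<lambda>i\<in>{..<m}. ?x (n + i))"
    using assms nm unfolding block_subadditive_def topspace_power_topology
    by (meson PiE_restrict UNIV_I restrict_PiE_iff)
  moreover have "(\<lambda>i\<in>{..<n}. ?x i) = restrict x {..<n}" by (auto simp: restrict_def)
  moreover have "(\<lambda>i\<in>{..<m}. ?x (n + i)) = (\<lambda>i\<in>{..<m}. x (n + i))" by (auto simp: restrict_def)
  ultimately show ?thesis using False by (simp only: block_potential_def) simp
qed (auto simp: block_potential_def)

lemma block_potential_blocks:
  assumes "block_subadditive F"
  shows "block_potential F (m * N + r) x \<le>
    (\<Sum>k<m. block_potential F N (\<lambda>i. x (k * N + i))) + block_potential F r (\<lambda>i. x (m * N + i))"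
\<comment> \<open>With \<open>r\<close> arbitrary, the next block can be split off the
  remainder.\<close>
proof (induction m arbitrary: r)
  case (Suc m)
  have "block_potential F (m * N + (N + r)) x \<le> (\<Sum>k<m. block_potential F N (\<lambda>i. x (k * N + i)))
      + block_potential F (N + r) (\<lambda>i. x (m * N + i))" by (rule Suc)
  also have "block_potential F (N + r) (\<lambda>i. x (m * N + i)) \<le> block_potential F N (\<lambda>i. x (m * N + i))
      + block_potential F r (\<lambda>i. x (m * N + (N + i)))" by (rule block_potential_add[OF assms])
  finally show ?case by (simp add: algebra_simps)
qed simp

lemma compactin_power_topology:
  assumes "compact (UNIV :: 'a::metric_space set)"
  shows "compactin (power_topology n :: (nat \<Rightarrow> 'a) topology) ({..<n} \<rightarrow>\<^sub>E UNIV)"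
proof -
  have "compact_space (euclidean :: 'a topology)"
    using assms by (simp add: compact_space_def)
  then have "compact_space (power_topology n :: (nat \<Rightarrow> 'a) topology)"
    unfolding power_topology_def by (auto simp: compact_space_product_topology)
  then show ?thesis by (simp add: compact_space_def)
qed

lemma block_potential_bounded:
  assumes "compact (UNIV :: 'a::metric_space set)" "block_subadditive (F :: nat \<Rightarrow> (nat \<Rightarrow> 'a) \<Rightarrow> real)"
  shows "\<exists>B\<ge>0. \<forall>x. \<bar>block_potential F n x\<bar> \<le> B"
proof (cases "n = 0")
  case False
  then have "continuous_map (power_topology n) euclideanreal (F n)"
    using assms(2) by (simp add: block_subadditive_def)
  with compactin_power_topology[OF assms(1)] have "compact (F n ` ({..<n} \<rightarrow>\<^sub>E UNIV))"
    using image_compactin by fastforce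
  then obtain B where B: "\<forall>x\<in>{..<n} \<rightarrow>\<^sub>E UNIV. \<bar>F n x\<bar> \<le> B"
    using compact_imp_bounded by (fastforce simp: bounded_iff)
  have "\<bar>block_potential F n x\<bar> \<le> B" for x
    using B False by (simp add: block_potential_def)
  moreover from this[of undefined] have "B \<ge> 0" by (meson abs_ge_zero order_trans)
  ultimately show ?thesis by auto
qed (auto simp: block_potential_def)

text \<open>Cut into blocks of length 1. The constant later pays for the ends left over by an offset
  and for the orbits that are not generic.\<close>

lemma block_potential_linear_bound:
  assumes "compact (UNIV :: 'a::metric_space set)" "block_subadditive (F :: nat \<Rightarrow> (nat \<Rightarrow> 'a) \<Rightarrow> real)"
  shows "\<exists>C\<ge>0. \<forall>n x. block_potential F n x \<le> real n * C"
proof -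
  obtain C where C: "C \<ge> 0" "\<And>x. \<bar>block_potential F 1 x\<bar> \<le> C"
    using block_potential_bounded[OF assms] by blast
  have "block_potential F n x \<le> real n * C" for n x
  proof -
    have "block_potential F n x \<le> (\<Sum>k<n. block_potential F 1 (\<lambda>i. x (k + i)))"
      using block_potential_blocks[OF assms(2), of n 1 0 x] by (simp add: block_potential_def)
    also have "\<dots> \<le> (\<Sum>k<n. C)" using C(2) by (intro sum_mono) (metis abs_le_D1)
    finally show ?thesis by simp
  qed
  with C(1) show ?thesis by blast
qed

text \<open>Translates product neighbourhoods into the summed distance, the quantity in which drift
  is measured and penalised.\<close>

lemma power_topology_nbhd:
  fixes T :: "(nat \<Rightarrow> 'a::metric_space) set"
  assumes "openin (power_topology n) T" "restrict y {..<n} \<in> T"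
  shows "\<exists>r>0. \<forall>z. (\<Sum>l<n. dist (z l) (y l)) < r \<longrightarrow> restrict z {..<n} \<in> T"
proof -
  obtain U where U: "\<And>l. l < n \<Longrightarrow> open (U l)" "restrict y {..<n} \<in> Pi\<^sub>E {..<n} U" "Pi\<^sub>E {..<n} U \<subseteq> T"
    using assms(1)[unfolded power_topology_def openin_product_topology_alt, rule_format, OF assms(2)]
    by auto
  have "\<exists>r>0. \<forall>a. dist a (y l) < r \<longrightarrow> a \<in> U l" if "l < n" for l
    using U(1)[OF that] U(2) that by (auto simp: open_dist)
  then obtain r where r: "\<And>l. l < n \<Longrightarrow> r l > 0" "\<And>l a. l < n \<Longrightarrow> dist a (y l) < r l \<Longrightarrow> a \<in> U l"
    by metis
  \<comment> \<open>Inserting 1 keeps the minimum over a nonempty set when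
    \<open>n = 0\<close>.\<close>
  define \<rho> where "\<rho> = Min (insert 1 (r ` {..<n}))"
  have "\<rho> > 0" using r(1) by (simp add: \<rho>_def)
  moreover have "restrict z {..<n} \<in> T" if z: "(\<Sum>l<n. dist (z l) (y l)) < \<rho>" for z
  proof -
    have "z l \<in> U l" if "l < n" for l
    proof (rule r(2)[OF that])
      have "dist (z l) (y l) \<le> (\<Sum>l<n. dist (z l) (y l))"
        using that by (intro member_le_sum) auto
      also note z
      also have "\<rho> \<le> r l" using that by (simp add: \<rho>_def)
      finally show "dist (z l) (y l) < r l" .
    qed
    then have "restrict z {..<n} \<in> Pi\<^sub>E {..<n} U" by (simp add: PiE_iff)
    with U(3) show ?thesis by (rule subsetD)
  qed
  ultimately show ?thesis by blast
qed

text \<open>The preimage of an open ray under the continuous \<open>F n\<close>. Only the upper half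
  of continuity is recorded, so that potentials and code lengths satisfy the same
  hypothesis.\<close>

lemma block_potential_usc:
  assumes "block_subadditive F" "\<epsilon> > 0"
  shows "\<exists>r>0. \<forall>z. (\<Sum>l<n. dist (z l) (y l)) < r \<longrightarrow> block_potential F n z \<le> block_potential F n y + \<epsilon>"
proof (cases "n = 0")
  case False
  let ?T = "{x \<in> topspace (power_topology n). F n x \<in> {..<F n (restrict y {..<n}) + \<epsilon>}}"
  have "openin (power_topology n) ?T"
    using assms(1) False
    by (intro openin_continuous_map_preimage[where Y = euclideanreal]) (auto simp: block_subadditive_def)
  moreover have "restrict y {..<n} \<in> ?T" using assms(2) by simp
  ultimately obtain r where "r > 0" "\<forall>z. (\<Sum>l<n. dist (z l) (y l)) < r \<longrightarrow> restrict z {..<n} \<in> ?T"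
    using power_topology_nbhd by blast
  then show ?thesis using False by (force simp: block_potential_def)
qed (use assms in \<open>auto simp: block_potential_def intro: exI[of _ 1]\<close>)

section \<open>Drift of pseudo-orbits away from true orbits\<close>

text \<open>Below the modulus \<open>d\<close> of uniform continuity the constant
  \<open>\<epsilon>\<close> suffices; above it the bound \<open>M\<close> on image distances is at
  most \<open>M / d\<close> times the distance. This replaces a Lipschitz condition on
  \<open>S\<close> and, unlike a modulus of continuity, can be summed along an orbit.\<close>

lemma uniformly_continuous_affine_bound:
  fixes S :: "'a::metric_space \<Rightarrow> 'b::metric_space"
  assumes "compact (UNIV :: 'a set)" "continuous_on UNIV S" "\<epsilon> > 0"
  shows "\<exists>C\<ge>0. \<forall>a b. dist (S a) (S b) \<le> \<epsilon> + C * dist a b"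
proof -
  have "uniformly_continuous_on UNIV S"
    using assms by (intro compact_uniformly_continuous) auto
  then obtain d where d: "d > 0" "\<And>a b. dist a b < d \<Longrightarrow> dist (S a) (S b) < \<epsilon>"
    using assms(3) unfolding uniformly_continuous_on_def by (metis UNIV_I dist_commute)
  have "bounded (range S)"
    using assms compact_continuous_image compact_imp_bounded by blast
  then obtain M where M: "\<And>a b. dist (S a) (S b) \<le> M"
    unfolding bounded_two_points by auto
  have "M \<ge> 0" using M zero_le_dist order_trans by blast
  have "dist (S a) (S b) \<le> \<epsilon> + M / d * dist a b" for a b
  proof (cases "dist a b < d")
    case True
    then have "dist (S a) (S b) < \<epsilon>" by (rule d(2))
    moreover have "M / d * dist a b \<ge> 0" using \<open>M \<ge> 0\<close> d(1) by simp
    ultimately show ?thesis by linarith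
  next
    case False
    then have "M * 1 \<le> M * (dist a b / d)"
      using \<open>M \<ge> 0\<close> d(1) by (intro mult_left_mono) auto
    then show ?thesis using M[of a b] assms(3) by simp
  qed
  then show ?thesis using \<open>M \<ge> 0\<close> d(1) by (intro exI[of _ "M / d"]) auto
qed

text \<open>Each step adds one new jump and sends the old drift through the affine bound for
  \<open>S\<close>. The result is linear in the jumps, however large they are, so it survives
  averaging over starting points.\<close>

lemma pseudo_orbit_drift:
  fixes S :: "'a::metric_space \<Rightarrow> 'a"
  assumes "compact (UNIV :: 'a set)" "continuous_on UNIV S" "\<epsilon> > 0"
  shows "\<exists>D\<ge>0. \<forall>x. dist (x l) ((S ^^ l) (x 0)) \<le> \<epsilon> + D * (\<Sum>m<l. dist (S (x m)) (x (Suc m)))"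
  using assms(3)
proof (induction l arbitrary: \<epsilon>)
  case 0
  then show ?case by (intro exI[of _ 0]) simp
next
  case (Suc l)
  have "\<epsilon> / 2 > 0" using Suc.prems by simp
  from uniformly_continuous_affine_bound[OF assms(1,2) this]
  obtain C where C: "C \<ge> 0" "\<And>a b. dist (S a) (S b) \<le> \<epsilon> / 2 + C * dist a b" by blast
  \<comment> \<open>The next application of \<open>S\<close> multiplies the old error by
    \<open>C\<close>; this choice keeps the product below \<open>\<epsilon> / 2\<close>, also for
    \<open>C = 0\<close>.\<close>
  have pos: "\<epsilon> / (2 * (C + 1)) > 0" using Suc.prems C(1) by simp
  from Suc.IH[OF this] obtain D where D: "D \<ge> 0"
    "\<And>x. dist (x l) ((S ^^ l) (x 0)) \<le> \<epsilon> / (2 * (C + 1)) + D * (\<Sum>m<l. dist (S (x m)) (x (Suc m)))"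
    by blast
  have "dist (x (Suc l)) ((S ^^ Suc l) (x 0)) \<le>
      \<epsilon> + (1 + C * D) * (\<Sum>m<Suc l. dist (S (x m)) (x (Suc m)))" for x
  proof -
    let ?\<sigma> = "\<Sum>m<l. dist (S (x m)) (x (Suc m))" and ?s = "dist (S (x l)) (x (Suc l))"
    have "dist (x (Suc l)) ((S ^^ Suc l) (x 0)) \<le> ?s + dist (S (x l)) (S ((S ^^ l) (x 0)))"
      by (metis dist_commute dist_triangle funpow.simps(2) o_apply)
    also have "dist (S (x l)) (S ((S ^^ l) (x 0))) \<le> \<epsilon> / 2 + C * dist (x l) ((S ^^ l) (x 0))"
      by (rule C(2))
    also have "C * dist (x l) ((S ^^ l) (x 0)) \<le> C * (\<epsilon> / (2 * (C + 1)) + D * ?\<sigma>)"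
      using C(1) D(2) by (rule mult_left_mono[rotated])
    also have "\<dots> \<le> \<epsilon> / 2 + C * D * ?\<sigma>"
    proof -
      have "C * (\<epsilon> / (2 * (C + 1))) = (C / (C + 1)) * (\<epsilon> / 2)" by simp
      also have "\<dots> \<le> 1 * (\<epsilon> / 2)" using C(1) Suc.prems by (intro mult_right_mono) auto
      finally show ?thesis by (simp add: distrib_left)
    qed
    finally have "dist (x (Suc l)) ((S ^^ Suc l) (x 0)) \<le> ?s + (\<epsilon> + C * D * ?\<sigma>)" by simp
    moreover have "C * D * ?s \<ge> 0" "?\<sigma> \<ge> 0" using C(1) D(1) by (auto intro: sum_nonneg)
    ultimately show ?thesis by (simp add: algebra_simps)
  qed
  then show ?case using C(1) D(1) by (intro exI[of _ "1 + C * D"]) auto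
qed

lemma pseudo_orbit_total_drift:
  fixes S :: "'a::metric_space \<Rightarrow> 'a"
  assumes "compact (UNIV :: 'a set)" "continuous_on UNIV S" "\<epsilon> > 0"
  shows "\<exists>D\<ge>0. \<forall>x. (\<Sum>l<N. dist (x l) ((S ^^ l) (x 0))) \<le> \<epsilon> + D * (\<Sum>m<N. dist (S (x m)) (x (Suc m)))"
  using assms(3)
proof (induction N arbitrary: \<epsilon>)
  case 0
  then show ?case by (intro exI[of _ 0]) simp
next
  case (Suc N)
  have "\<epsilon> / 2 > 0" using Suc.prems by simp
  from Suc.IH[OF this] obtain D where D: "D \<ge> 0" "\<And>x. (\<Sum>l<N. dist (x l) ((S ^^ l) (x 0))) \<le>
      \<epsilon> / 2 + D * (\<Sum>m<N. dist (S (x m)) (x (Suc m)))" by blast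
  from pseudo_orbit_drift[OF assms(1,2) \<open>\<epsilon> / 2 > 0\<close>, of N]
  obtain E where E: "E \<ge> 0" "\<And>x. dist (x N) ((S ^^ N) (x 0)) \<le>
      \<epsilon> / 2 + E * (\<Sum>m<N. dist (S (x m)) (x (Suc m)))" by blast
  have "(\<Sum>l<Suc N. dist (x l) ((S ^^ l) (x 0))) \<le>
      \<epsilon> + (D + E) * (\<Sum>m<Suc N. dist (S (x m)) (x (Suc m)))" for x
  proof -
    have "(\<Sum>l<Suc N. dist (x l) ((S ^^ l) (x 0))) \<le> \<epsilon> + (D + E) * (\<Sum>m<N. dist (S (x m)) (x (Suc m)))"
      using D(2)[of x] E(2)[of x] by (simp add: algebra_simps)
    also have "\<dots> \<le> \<epsilon> + (D + E) * (\<Sum>m<Suc N. dist (S (x m)) (x (Suc m)))"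
      using D(1) E(1) by (intro add_left_mono mult_left_mono) auto
    finally show ?thesis .
  qed
  then show ?case using D(1) E(1) by (intro exI[of _ "D + E"]) auto
qed

section \<open>The mean potential along true orbits\<close>

context invariant_system
begin

lemma continuous_map_orbit: "continuous_map euclidean (power_topology n) (\<lambda>y. \<lambda>i\<in>{..<n}. (S ^^ i) y)"
  unfolding power_topology_def continuous_map_componentwise
  using continuous_iterate by auto

lemma continuous_block_potential_orbit:
  assumes "block_subadditive F"
  shows "continuous_on UNIV (\<lambda>y. block_potential F n (\<lambda>l. (S ^^ l) y))"
proof (cases "n = 0")
  case False
  then have "continuous_map (power_topology n) euclideanreal (F n)"
    using assms by (simp add: block_subadditive_def)
  from continuous_map_compose[OF continuous_map_orbit this] show ?thesis
    using False by (simp add: block_potential_def comp_def)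
qed (simp add: block_potential_def)

definition mean_block_potential :: "(nat \<Rightarrow> (nat \<Rightarrow> 'a) \<Rightarrow> real) \<Rightarrow> nat \<Rightarrow> real" where
  "mean_block_potential F n = (\<integral>y. block_potential F n (\<lambda>l. (S ^^ l) y) \<partial>\<mu>)"

text \<open>Invariance turns the pointwise inequality along orbits into sub-additivity of the
  integrals, and \<open>fekete\<close> identifies the limit as an infimum, which also yields the
  second claim.\<close>

lemma potential_mean_tendsto:
  assumes F: "block_subadditive F"
  shows "(\<lambda>n. ereal (mean_block_potential F n / real n)) \<longlonglongrightarrow> potential_mean \<mu> (induced_potential S F)"
    and "n \<ge> 1 \<Longrightarrow> potential_mean \<mu> (induced_potential S F) \<le> ereal (mean_block_potential F n / real n)"
proof -
  let ?f = "\<lambda>n y. block_potential F n (\<lambda>l. (S ^^ l) y)"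
  let ?L = "INF n\<in>{1..}. ereal (mean_block_potential F n / real n)"
  have int: "integrable \<mu> (?f n)" for n
    using continuous_block_potential_orbit[OF F] by (rule integrable_continuous)
  have meas: "?f n \<in> borel_measurable borel" for n
    using continuous_block_potential_orbit[OF F] by (rule borel_measurable_continuous_onI)
  have "mean_block_potential F (m + n) \<le> mean_block_potential F m + mean_block_potential F n" for m n
  proof -
    have pw: "?f (m + n) y \<le> ?f m y + ?f n ((S ^^ m) y)" for y
    proof -
      have "(\<lambda>i. (S ^^ (m + i)) y) = (\<lambda>l. (S ^^ l) ((S ^^ m) y))"
        by (simp add: add.commute[of m] funpow_add)
      then show ?thesis using block_potential_add[OF F, of m n "\<lambda>l. (S ^^ l) y"] by simp
    qed
    have int': "integrable \<mu> (\<lambda>y. ?f n ((S ^^ m) y))"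
      using continuous_on_compose2[OF continuous_block_potential_orbit[OF F] continuous_iterate]
      by (intro integrable_continuous) auto
    have "mean_block_potential F (m + n) \<le> (\<integral>y. ?f m y + ?f n ((S ^^ m) y) \<partial>\<mu>)"
      unfolding mean_block_potential_def using int int' pw by (intro integral_mono) auto
    also have "\<dots> = mean_block_potential F m + (\<integral>y. ?f n ((S ^^ m) y) \<partial>\<mu>)"
      unfolding mean_block_potential_def by (rule Bochner_Integration.integral_add[OF int int'])
    also have "(\<integral>y. ?f n ((S ^^ m) y) \<partial>\<mu>) = mean_block_potential F n"
      unfolding mean_block_potential_def by (rule integral_iterate[OF meas])
    finally show ?thesis .
  qed
  then have lim: "(\<lambda>n. ereal (mean_block_potential F n / real n)) \<longlonglongrightarrow> ?L"
    by (rule fekete)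
  have "(\<lambda>n. ereal ((\<integral>y. induced_potential S F n y \<partial>\<mu>) / real n)) =
      (\<lambda>n. ereal (mean_block_potential F n / real n))"
  proof
    fix n
    \<comment> \<open>At \<open>n = 0\<close> both quotients divide by zero and are 0, whatever
      \<open>F 0\<close> is.\<close>
    show "ereal ((\<integral>y. induced_potential S F n y \<partial>\<mu>) / real n) = ereal (mean_block_potential F n / real n)"
      by (cases "n = 0") (simp_all add: mean_block_potential_def block_potential_def induced_potential_def)
  qed
  then have eq: "potential_mean \<mu> (induced_potential S F) = ?L"
    unfolding potential_mean_def using lim by (simp add: limI)
  show "(\<lambda>n. ereal (mean_block_potential F n / real n)) \<longlonglongrightarrow> potential_mean \<mu> (induced_potential S F)"
    unfolding eq by (rule lim)
  show "n \<ge> 1 \<Longrightarrow> potential_mean \<mu> (induced_potential S F) \<le> ereal (mean_block_potential F n / real n)"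
    unfolding eq by (rule INF_lower) simp
qed

end

section \<open>Block functions along generic pseudo-orbits\<close>

text \<open>Each \<open>s i\<close> is counted at most once for every \<open>j < N\<close>. The
  indices stay in range because \<open>i + j \<le> q + N - 2 < m\<close>.\<close>

lemma sum_shift_le:
  fixes s :: "nat \<Rightarrow> real"
  assumes "\<And>i. s i \<ge> 0" "q + N \<le> Suc m"
  shows "(\<Sum>i<q. \<Sum>j<N. s (i + j)) \<le> real N * (\<Sum>i<m. s i)"
proof -
  have "(\<Sum>i<q. s (i + j)) \<le> (\<Sum>i<m. s i)" if "j < N" for j
  proof -
    have "(\<Sum>i<q. s (i + j)) = sum s ((\<lambda>i. i + j) ` {..<q})"
      by (simp add: sum.reindex)
    also have "\<dots> \<le> (\<Sum>i<m. s i)"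
      using assms that by (intro sum_mono2) auto
    finally show ?thesis .
  qed
  then have "(\<Sum>j<N. \<Sum>i<q. s (i + j)) \<le> (\<Sum>j<N. \<Sum>i<m. s i)"
    by (intro sum_mono) auto
  then show ?thesis by (subst sum.swap) simp
qed

text \<open>One block fewer than fits leaves room to shift all blocks by any offset below
  \<open>N\<close>, at the price of at most \<open>2 * N\<close> uncovered positions. Natural
  subtraction gives 0 blocks for short words.\<close>

lemma blocks_fit:
  fixes n N :: nat
  assumes "N \<ge> 1"
  shows "(n div N - 1) * N \<le> n" "n \<le> (n div N - 1) * N + 2 * N"
    "n div N - 1 > 0 \<Longrightarrow> (n div N - 1) * N + N \<le> n"
proof -
  have n: "n = n div N * N + n mod N" "n mod N < N" using assms by auto
  show "(n div N - 1) * N \<le> n" "n \<le> (n div N - 1) * N + 2 * N"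
    "n div N - 1 > 0 \<Longrightarrow> (n div N - 1) * N + N \<le> n"
    using n by (cases "n div N"; simp; linarith)+
qed

context invariant_system
begin

text \<open>A sup-convolution: \<open>G k\<close> maximises \<open>\<phi>\<close> with penalty
  \<open>k\<close> times the distance to the orbit of \<open>y\<close>. Semicontinuity makes
  \<open>G k\<close> converge to \<open>\<phi>\<close> along true orbits as \<open>k\<close> grows,
  and dominated convergence transfers this to the integrals.\<close>

lemma upper_regularization:
  fixes \<phi> :: "(nat \<Rightarrow> 'a) \<Rightarrow> real"
  assumes bound: "\<And>z. \<bar>\<phi> z\<bar> \<le> B"
    and usc: "\<And>y \<epsilon>. \<epsilon> > 0 \<Longrightarrow> \<exists>r>0. \<forall>z. (\<Sum>l<N. dist (z l) ((S ^^ l) y)) < r \<longrightarrow> \<phi> z \<le> \<phi> (\<lambda>l. (S ^^ l) y) + \<epsilon>"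
  shows "integrable \<mu> (\<lambda>y. \<phi> (\<lambda>l. (S ^^ l) y))"
    and "\<epsilon> > 0 \<Longrightarrow> \<exists>G k. continuous_on UNIV G \<and> k \<ge> 0 \<and>
      (\<forall>z. \<phi> z \<le> G (z 0) + k * (\<Sum>l<N. dist (z l) ((S ^^ l) (z 0)))) \<and>
      (\<integral>y. G y \<partial>\<mu>) \<le> (\<integral>y. \<phi> (\<lambda>l. (S ^^ l) y) \<partial>\<mu>) + \<epsilon>"
proof -
  define E where "E = (\<lambda>z y. \<Sum>l<N. dist (z l) ((S ^^ l) y))"
  define G where "G = (\<lambda>k y. SUP z. \<phi> z - real k * E z y)"
  let ?o = "\<lambda>y. \<phi> (\<lambda>l. (S ^^ l) y)"
  have E0: "E z y \<ge> 0" for z y by (simp add: E_def sum_nonneg)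
  have le_B: "\<phi> z - real k * E z y \<le> B" for z k y
  proof -
    have "real k * E z y \<ge> 0" using E0 by simp
    then show ?thesis using bound[of z] by linarith
  qed
  have bdd: "bdd_above (range (\<lambda>z. \<phi> z - real k * E z y))" for k y
    using le_B by (intro bdd_aboveI[of _ B]) auto
  have G_ge: "\<phi> z - real k * E z y \<le> G k y" for z k y
    unfolding G_def by (rule cSUP_upper[OF UNIV_I bdd])
  have G_le: "G k y \<le> c" if "\<And>z. \<phi> z - real k * E z y \<le> c" for k y c
    unfolding G_def using that by (intro cSUP_least) auto
  have orbit_le: "?o y \<le> G k y" for k y
    using G_ge[of "\<lambda>l. (S ^^ l) y" k y] by (simp add: E_def)
  have G_bound: "\<bar>G k y\<bar> \<le> B" for k y
  proof -
    have "G k y \<le> B" by (rule G_le) (rule le_B)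
    then show ?thesis using orbit_le[of y k] bound[of "\<lambda>l. (S ^^ l) y"] by linarith
  qed
  have cont: "continuous_on UNIV (G k)" for k
  proof -
    \<comment> \<open>The triangle inequality moves the penalty from one orbit to the other;
      continuity of the iterates then gives continuity of \<open>G k\<close>.\<close>
    have diff: "G k x \<le> G k y + real k * (\<Sum>l<N. dist ((S ^^ l) x) ((S ^^ l) y))" for x y
    proof (rule G_le)
      fix z
      have "E z y \<le> E z x + (\<Sum>l<N. dist ((S ^^ l) x) ((S ^^ l) y))"
        unfolding E_def sum.distrib[symmetric] by (intro sum_mono dist_triangle)
      then have "real k * E z y \<le> real k * (E z x + (\<Sum>l<N. dist ((S ^^ l) x) ((S ^^ l) y)))"
        by (rule mult_left_mono) simp
      with G_ge[of z k y] show "\<phi> z - real k * E z x \<le> G k y + real k * (\<Sum>l<N. dist ((S ^^ l) x) ((S ^^ l) y))"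
        by (simp add: distrib_left)
    qed
    have "(G k \<longlongrightarrow> G k y) (at y)" for y
    proof (rule LIM_zero_cancel, rule Lim_null_comparison)
      show "\<forall>\<^sub>F x in at y. norm (G k x - G k y) \<le> real k * (\<Sum>l<N. dist ((S ^^ l) x) ((S ^^ l) y))"
        using diff[of _ y] diff[of y] by (intro always_eventually allI) (simp add: abs_le_iff dist_commute diff_le_eq add.commute)
      have "isCont (S ^^ l) y" for l
        using continuous_iterate[of l] by (simp add: continuous_on_eq_continuous_at)
      then have "((S ^^ l) \<longlongrightarrow> (S ^^ l) y) (at y)" for l by (simp add: isCont_def)
      then have "((\<lambda>x. real k * (\<Sum>l<N. dist ((S ^^ l) x) ((S ^^ l) y))) \<longlongrightarrow>
          real k * (\<Sum>l<N. dist ((S ^^ l) y) ((S ^^ l) y))) (at y)"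
        by (intro tendsto_intros)
      then show "((\<lambda>x. real k * (\<Sum>l<N. dist ((S ^^ l) x) ((S ^^ l) y))) \<longlongrightarrow> 0) (at y)" by simp
    qed
    then show ?thesis by (simp add: continuous_on_eq_continuous_at isCont_def)
  qed
  have lim: "(\<lambda>k. G k y) \<longlonglongrightarrow> ?o y" for y
  proof (rule LIMSEQ_I)
    fix e :: real assume "e > 0"
    then have "e / 2 > 0" by simp
    from usc[OF this, of y] have "\<exists>r>0. \<forall>z. E z y < r \<longrightarrow> \<phi> z \<le> ?o y + e / 2"
      by (simp only: E_def)
    then obtain r where r: "r > 0" "\<And>z. E z y < r \<Longrightarrow> \<phi> z \<le> ?o y + e / 2" by blast
    \<comment> \<open>From \<open>K\<close> on, the penalty at distance \<open>r\<close> exceeds the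
      oscillation \<open>2 * B\<close> of \<open>\<phi>\<close>, so blocks far from the orbit cannot
      win the supremum.\<close>
    obtain K :: nat where K: "2 * B < real K * r"
      using ex_less_of_nat_mult[OF r(1)] by blast
    have "norm (G k y - ?o y) < e" if k: "k \<ge> K" for k
    proof -
      have "G k y \<le> ?o y + e / 2"
      proof (rule G_le)
        fix z
        show "\<phi> z - real k * E z y \<le> ?o y + e / 2"
        proof (cases "E z y < r")
          case True
          have "real k * E z y \<ge> 0" using E0 by simp
          with r(2)[OF True] show ?thesis by linarith
        next
          case False
          then have "real K * r \<le> real k * E z y" using k r(1) by (intro mult_mono) auto
          then show ?thesis
            using K bound[of z] bound[of "\<lambda>l. (S ^^ l) y"] \<open>e > 0\<close> by linarith
        qed
      qed
      with orbit_le[of y k] \<open>e > 0\<close> show ?thesis by simp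
    qed
    then show "\<exists>K. \<forall>k\<ge>K. norm (G k y - ?o y) < e" by blast
  qed
  have meas: "G k \<in> borel_measurable \<mu>" for k
    using borel_measurable_integrable[OF integrable_continuous[OF cont]] .
  \<comment> \<open>Measurability along orbits is inherited from the continuous
    approximations.\<close>
  have meas_o: "?o \<in> borel_measurable \<mu>"
    by (rule borel_measurable_LIMSEQ_real[where u = G]) (rule lim, rule meas)
  show int_o: "integrable \<mu> ?o"
    using meas_o bound by (intro integrable_const_bound[where B = B]) auto
  have "(\<lambda>k. \<integral>y. G k y \<partial>\<mu>) \<longlonglongrightarrow> (\<integral>y. ?o y \<partial>\<mu>)"
    using meas meas_o lim G_bound
    by (intro integral_dominated_convergence[where w = "\<lambda>_. B"]) auto
  moreover assume "\<epsilon> > 0"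
  ultimately have "\<forall>\<^sub>F k in sequentially. (\<integral>y. G k y \<partial>\<mu>) < (\<integral>y. ?o y \<partial>\<mu>) + \<epsilon>"
    by (intro order_tendstoD(2)) auto
  then obtain k where "(\<integral>y. G k y \<partial>\<mu>) < (\<integral>y. ?o y \<partial>\<mu>) + \<epsilon>"
    by (auto simp: eventually_sequentially)
  \<comment> \<open>Taking \<open>y = z 0\<close> measures the block against the orbit of its own
    first point, which is what the drift bound controls.\<close>
  moreover have "\<phi> z \<le> G k (z 0) + real k * (\<Sum>l<N. dist (z l) ((S ^^ l) (z 0)))" for z
    using G_ge[of z k "z 0"] by (simp add: E_def)
  ultimately show "\<exists>G k. continuous_on UNIV G \<and> k \<ge> 0 \<and>
      (\<forall>z. \<phi> z \<le> G (z 0) + k * (\<Sum>l<N. dist (z l) ((S ^^ l) (z 0)))) \<and>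
      (\<integral>y. G y \<partial>\<mu>) \<le> (\<integral>y. ?o y \<partial>\<mu>) + \<epsilon>"
    using cont by (intro exI[of _ "G k"] exI[of _ "real k"]) auto
qed

text \<open>With the continuous majorant as test function, genericity controls the sum of its
  values, and the remaining penalty is a multiple of the total jump. Summing over every starting
  point, rather than over one family of disjoint blocks, is what permits a comparison with a
  Birkhoff sum.\<close>

lemma sum_blocks_le_generic:
  fixes \<phi> :: "(nat \<Rightarrow> 'a) \<Rightarrow> real"
  assumes bound: "\<And>z. \<bar>\<phi> z\<bar> \<le> B"
    and usc: "\<And>y \<epsilon>. \<epsilon> > 0 \<Longrightarrow> \<exists>r>0. \<forall>z. (\<Sum>l<N. dist (z l) ((S ^^ l) y)) < r \<longrightarrow> \<phi> z \<le> \<phi> (\<lambda>l. (S ^^ l) y) + \<epsilon>"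
    and N: "N \<ge> 1" and \<epsilon>: "\<epsilon> > 0"
  shows "\<exists>g \<delta> C. continuous_on UNIV g \<and> \<delta> > 0 \<and> (\<forall>n\<ge>2. \<forall>x\<in>generic_pseudo_orbits S n \<delta> \<mu> {g}.
    (\<Sum>i<(n div N - 1) * N. \<phi> (\<lambda>l. x (i + l))) \<le> real n * ((\<integral>y. \<phi> (\<lambda>l. (S ^^ l) y) \<partial>\<mu>) + \<epsilon>) + C)"
proof -
  let ?I = "\<integral>y. \<phi> (\<lambda>l. (S ^^ l) y) \<partial>\<mu>"
  obtain G k where G: "continuous_on UNIV G" "k \<ge> 0"
    "\<And>z. \<phi> z \<le> G (z 0) + k * (\<Sum>l<N. dist (z l) ((S ^^ l) (z 0)))" "(\<integral>y. G y \<partial>\<mu>) \<le> ?I + \<epsilon> / 4"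
    using upper_regularization(2)[where \<phi> = \<phi> and N = N, OF bound usc, of "\<epsilon> / 4"] \<epsilon> by auto
  obtain M where M: "M \<ge> 0" "\<And>y. \<bar>G y\<bar> \<le> M" using continuous_bounded[OF G(1)] by metis
  have contS: "continuous_on UNIV S" using tds by (simp add: tds_def)
  \<comment> \<open>Makes \<open>k * \<eta>\<close> at most \<open>\<epsilon> / 4\<close>; the added
    1 covers \<open>k = 0\<close>.\<close>
  define \<eta> where "\<eta> = \<epsilon> / (4 * (k + 1))"
  have "\<eta> > 0" using \<epsilon> G(2) by (simp add: \<eta>_def)
  from pseudo_orbit_total_drift[OF compact_UNIV contS this, of N]
  obtain D where D: "D \<ge> 0" "\<And>x. (\<Sum>l<N. dist (x l) ((S ^^ l) (x 0))) \<le>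
      \<eta> + D * (\<Sum>m<N. dist (S (x m)) (x (Suc m)))" by blast
  have k\<eta>: "k * \<eta> \<le> \<epsilon> / 4"
  proof -
    have "k * \<eta> = (k / (k + 1)) * (\<epsilon> / 4)" by (simp add: \<eta>_def)
    also have "\<dots> \<le> 1 * (\<epsilon> / 4)" using G(2) \<epsilon> by (intro mult_right_mono) auto
    finally show ?thesis by simp
  qed
  \<comment> \<open>The four quarters of \<open>\<epsilon>\<close> go to the integral of
    \<open>G\<close>, the tolerance of genericity, the constant part of the drift, and the jumps.
    Each jump is counted at most \<open>N\<close> times, hence the factor \<open>N\<close>.\<close>
  define \<delta> where "\<delta> = min (\<epsilon> / 4) (\<epsilon> / (4 * (k * D * real N + 1)))"
  have kDN: "k * D * real N \<ge> 0" using G(2) D(1) by simp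
  have "\<epsilon> / (4 * (k * D * real N + 1)) > 0" using \<epsilon> kDN by (intro divide_pos_pos) auto
  then have \<delta>: "\<delta> > 0" "\<delta> \<le> \<epsilon> / 4"
    using \<epsilon> unfolding \<delta>_def by (simp_all only: min.cobounded1 min_less_iff_conj) simp
  have kDN\<delta>: "k * D * real N * \<delta> \<le> \<epsilon> / 4"
  proof -
    have "k * D * real N * \<delta> \<le> k * D * real N * (\<epsilon> / (4 * (k * D * real N + 1)))"
      using kDN by (intro mult_left_mono) (simp_all add: \<delta>_def)
    also have "\<dots> = (k * D * real N / (k * D * real N + 1)) * (\<epsilon> / 4)" by simp
    also have "\<dots> \<le> 1 * (\<epsilon> / 4)" using kDN \<epsilon> by (intro mult_right_mono) auto
    finally show ?thesis by simp
  qed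
  have main: "(\<Sum>i<(n div N - 1) * N. \<phi> (\<lambda>l. x (i + l))) \<le> real n * (?I + \<epsilon>) + 2 * real N * M"
    if n: "n \<ge> 2" and x: "x \<in> generic_pseudo_orbits S n \<delta> \<mu> {G}" for n x
  proof -
    define q where "q = (n div N - 1) * N"
    define s where "s = (\<lambda>m. dist (S (x m)) (x (Suc m)))"
    have q: "q \<le> n" "n \<le> q + 2 * N" and q': "q > 0 \<Longrightarrow> q + N \<le> n"
      using blocks_fit[OF N, of n] by (auto simp: q_def)
    have avg: "\<bar>(\<Sum>i<n. G (x i)) / real n - (\<integral>y. G y \<partial>\<mu>)\<bar> \<le> \<delta>"
      and "(\<Sum>i<n - 1. s i) / real (n - 1) \<le> \<delta>"
      using x by (auto simp: generic_pseudo_orbits_def avg_pseudo_orbits_def s_def)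
    then have "(\<Sum>i<n - 1. s i) \<le> \<delta> * real (n - 1)" using n by (simp add: pos_divide_le_eq)
    also have "\<dots> \<le> \<delta> * real n" using \<delta>(1) by (intro mult_left_mono) auto
    finally have s_le: "(\<Sum>i<n - 1. s i) \<le> \<delta> * real n" .
    have "(\<Sum>i<n. G (x i)) / real n \<le> ?I + \<epsilon> / 2"
      using avg \<delta>(2) G(4) by linarith
    then have G_sum: "(\<Sum>i<n. G (x i)) \<le> real n * (?I + \<epsilon> / 2)"
      using n by (simp add: pos_divide_le_eq mult.commute)
    have ss: "(\<Sum>i<q. \<Sum>j<N. s (i + j)) \<le> real N * (\<Sum>i<n - 1. s i)"
    proof (cases "q = 0")
      case False
      then show ?thesis using q' n by (intro sum_shift_le) (auto simp: s_def)
    qed (auto simp: s_def intro!: mult_nonneg_nonneg sum_nonneg)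
    have "(\<Sum>i<q. \<phi> (\<lambda>l. x (i + l))) \<le> (\<Sum>i<q. G (x i) + (k * \<eta> + k * D * (\<Sum>j<N. s (i + j))))"
    proof (rule sum_mono)
      fix i
      have "\<phi> (\<lambda>l. x (i + l)) \<le> G (x i) + k * (\<Sum>l<N. dist (x (i + l)) ((S ^^ l) (x i)))"
        using G(3)[of "\<lambda>l. x (i + l)"] by simp
      also have "k * (\<Sum>l<N. dist (x (i + l)) ((S ^^ l) (x i))) \<le> k * (\<eta> + D * (\<Sum>j<N. s (i + j)))"
        using D(2)[of "\<lambda>l. x (i + l)"] G(2) by (intro mult_left_mono) (simp_all add: s_def)
      finally show "\<phi> (\<lambda>l. x (i + l)) \<le> G (x i) + (k * \<eta> + k * D * (\<Sum>j<N. s (i + j)))"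
        by (simp add: algebra_simps)
    qed
    also have "\<dots> = (\<Sum>i<q. G (x i)) + real q * (k * \<eta>) + k * D * (\<Sum>i<q. \<Sum>j<N. s (i + j))"
      by (simp add: sum.distrib sum_distrib_left)
    also have "real q * (k * \<eta>) \<le> real n * (\<epsilon> / 4)"
      using q(1) k\<eta> G(2) \<open>\<eta> > 0\<close> by (intro mult_mono) auto
    also have "k * D * (\<Sum>i<q. \<Sum>j<N. s (i + j)) \<le> k * D * (real N * (\<delta> * real n))"
      using G(2) D(1) by (intro mult_left_mono order_trans[OF ss] s_le) auto
    also have "\<dots> = real n * (k * D * real N * \<delta>)" by simp
    also have "\<dots> \<le> real n * (\<epsilon> / 4)" using kDN\<delta> by (rule mult_left_mono) simp
    \<comment> \<open>Genericity speaks about all \<open>n\<close> positions; the at most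
      \<open>2 * N\<close> omitted ones contribute at least \<open>- M\<close> each.\<close>
    also have "(\<Sum>i<q. G (x i)) \<le> real n * (?I + \<epsilon> / 2) + 2 * real N * M"
    proof -
      have "(\<Sum>i<n. G (x i)) = (\<Sum>i<q. G (x i)) + (\<Sum>i\<in>{q..<n}. G (x i))"
        using sum.atLeastLessThan_concat[of 0 q n "\<lambda>i. G (x i)"] q(1) by (simp add: lessThan_atLeast0)
      moreover have "(\<Sum>i\<in>{q..<n}. G (x i)) \<ge> (\<Sum>i\<in>{q..<n}. - M)"
        using M(2) by (intro sum_mono) (smt (verit))
      moreover have "real (n - q) * M \<le> 2 * real N * M"
        using q(2) M(1) by (intro mult_right_mono) auto
      ultimately show ?thesis using G_sum by simp
    qed
    finally show ?thesis by (simp add: q_def algebra_simps)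
  qed
  show ?thesis using G(1) \<delta>(1) main by blast
qed

lemma generic_pseudo_orbits_mono:
  assumes "\<delta>' \<le> \<delta>" "L \<subseteq> L'"
  shows "generic_pseudo_orbits S n \<delta>' \<mu> L' \<subseteq> generic_pseudo_orbits S n \<delta> \<mu> L"
  using assms unfolding generic_pseudo_orbits_def avg_pseudo_orbits_def by fastforce

end

section \<open>The upper bound\<close>

lemma ext_log_le: "x \<le> ennreal (exp t) \<Longrightarrow> ext_log x \<le> ereal t"
proof (cases x)
  case (real r)
  assume "x \<le> ennreal (exp t)"
  then have "r \<le> exp t" using real by (simp add: ennreal_le_iff)
  then show ?thesis using real
  proof (cases "r = 0")
    case False
    then have "ln r \<le> ln (exp t)" using \<open>r \<le> exp t\<close> real by (intro ln_mono) auto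
    then show ?thesis using False real by (simp add: ext_log_def)
  qed (simp add: ext_log_def)
qed (auto simp: ext_log_def top_unique)

lemma ext_log_ge: "ennreal (exp t) \<le> x \<Longrightarrow> ereal t \<le> ext_log x"
proof (cases x)
  case (real r)
  assume "ennreal (exp t) \<le> x"
  then have "exp t \<le> r" using real by (simp add: ennreal_le_iff2)
  moreover from this have "r > 0" using exp_gt_zero[of t] by linarith
  ultimately show ?thesis using real by (auto simp: ext_log_def ln_ge_iff)
qed (auto simp: ext_log_def)

section \<open>Counting words and averaging over offsets\<close>

text \<open>Give a sequence of blocks the product of the weights \<open>exp (- c b)\<close>. The
  total weight is at most 1 by Kraft's inequality, and every counted sequence weighs at least
  \<open>exp (- a)\<close>.\<close>

lemma kraft_count:
  fixes c :: "'b \<Rightarrow> real"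
  assumes "finite B" "(\<Sum>b\<in>B. exp (- c b)) \<le> 1"
  shows "real (card {\<beta> \<in> {..<m::nat} \<rightarrow>\<^sub>E B. (\<Sum>k<m. c (\<beta> k)) \<le> a}) \<le> exp a"
proof -
  let ?W = "{\<beta> \<in> {..<m} \<rightarrow>\<^sub>E B. (\<Sum>k<m. c (\<beta> k)) \<le> a}"
  have fin: "finite ({..<m} \<rightarrow>\<^sub>E B)" using assms(1) by (simp add: finite_PiE)
  have "real (card ?W) * exp (- a) = (\<Sum>\<beta>\<in>?W. exp (- a))" by simp
  also have "\<dots> \<le> (\<Sum>\<beta>\<in>?W. \<Prod>k<m. exp (- c (\<beta> k)))"
  proof (rule sum_mono)
    fix \<beta> assume "\<beta> \<in> ?W"
    then have "- a \<le> (\<Sum>k<m. - c (\<beta> k))" by (simp add: sum_negf)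
    then have "exp (- a) \<le> exp (\<Sum>k<m. - c (\<beta> k))" by (simp only: exp_le_cancel_iff)
    then show "exp (- a) \<le> (\<Prod>k<m. exp (- c (\<beta> k)))" by (subst (asm) exp_sum) simp_all
  qed
  also have "\<dots> \<le> (\<Sum>\<beta>\<in>{..<m} \<rightarrow>\<^sub>E B. \<Prod>k<m. exp (- c (\<beta> k)))"
    by (rule sum_mono2[OF fin]) (simp_all add: prod_nonneg)
  also have "\<dots> = (\<Sum>b\<in>B. exp (- c b)) ^ m"
    using prod_sum_PiE[of "{..<m}" "\<lambda>_. B" "\<lambda>_ b. exp (- c b)"] assms(1) by simp
  also have "\<dots> \<le> 1" using assms(2) by (intro power_le_one) (auto intro: sum_nonneg)
  finally show ?thesis by (simp add: exp_minus field_simps)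
qed

text \<open>Writing \<open>i = j + k * N\<close> turns a sum over all starting points into
  \<open>N\<close> sums over consecutive disjoint blocks, one for each offset.\<close>

lemma sum_offset_blocks:
  fixes f :: "nat \<Rightarrow> 'b::comm_monoid_add"
  shows "(\<Sum>i<m * N. f i) = (\<Sum>j<N. \<Sum>k<m. f (j + k * N))"
proof -
  have "(\<Sum>i<m * N. f i) = (\<Sum>k<m. \<Sum>i\<in>{k * N..<k * N + N}. f i)"
    by (rule sum.nat_group[symmetric])
  also have "\<dots> = (\<Sum>k<m. \<Sum>j<N. f (j + k * N))"
  proof (rule sum.cong[OF refl])
    fix k
    show "(\<Sum>i\<in>{k * N..<k * N + N}. f i) = (\<Sum>j<N. f (j + k * N))"
      using sum.shift_bounds_nat_ivl[of f 0 "k * N" N] by (simp add: lessThan_atLeast0 add.commute)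
  qed
  finally show ?thesis by (subst sum.swap)
qed

definition words :: "'a set set \<Rightarrow> nat \<Rightarrow> (nat \<Rightarrow> 'a set) set" where
  "words \<U> n = {..<n} \<rightarrow>\<^sub>E \<U>"

text \<open>Members of an open cover overlap, so a block can carry several names. Taking the
  cheapest one makes the cost upper semicontinuous.\<close>

definition word_cost :: "((nat \<Rightarrow> 'a set) \<Rightarrow> real) \<Rightarrow> 'a set set \<Rightarrow> nat \<Rightarrow> (nat \<Rightarrow> 'a) \<Rightarrow> real" where
  "word_cost c \<U> N z = Min (c ` {w \<in> words \<U> N. \<forall>l<N. z l \<in> w l})"

lemma finite_words: "finite \<U> \<Longrightarrow> finite (words \<U> n)"
  by (simp add: words_def finite_PiE)

lemma word_cost_attained:
  assumes "finite \<U>" "\<Union>\<U> = UNIV"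
  obtains w where "w \<in> words \<U> N" "\<forall>l<N. z l \<in> w l" "word_cost c \<U> N z = c w"
proof -
  let ?A = "{w \<in> words \<U> N. \<forall>l<N. z l \<in> w l}"
  have "\<forall>y. \<exists>U. U \<in> \<U> \<and> y \<in> U" using assms(2) by blast
  then obtain U where U: "\<And>y. U y \<in> \<U>" "\<And>y. y \<in> U y" by metis
  have "(\<lambda>l\<in>{..<N}. U (z l)) \<in> ?A" using U by (auto simp: words_def)
  then have "c ` ?A \<noteq> {}" by blast
  moreover have "finite (c ` ?A)" using finite_words[OF assms(1), of N] by auto
  ultimately have "word_cost c \<U> N z \<in> c ` ?A" unfolding word_cost_def by (intro Min_in)
  then show ?thesis by (auto intro: that)
qed

lemma word_cost_le:
  assumes "finite \<U>" "w \<in> words \<U> N" "\<And>l. l < N \<Longrightarrow> z l \<in> w l"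
  shows "word_cost c \<U> N z \<le> c w"
  unfolding word_cost_def using assms finite_words[OF assms(1), of N] by (intro Min_le) auto

lemma word_cost_bounded:
  assumes "finite \<U>" "\<Union>\<U> = UNIV"
  shows "\<bar>word_cost c \<U> N z\<bar> \<le> (\<Sum>w\<in>words \<U> N. \<bar>c w\<bar>)"
proof -
  obtain w where w: "w \<in> words \<U> N" "word_cost c \<U> N z = c w"
    using word_cost_attained[OF assms, where z = z and N = N and c = c] by metis
  then show ?thesis using member_le_sum[of w "words \<U> N" "\<lambda>w. \<bar>c w\<bar>"] finite_words[OF assms(1)] by simp
qed

lemma open_coversD:
  assumes "\<U> \<in> open_covers euclidean"
  shows "\<U> \<in> covers euclidean" "finite \<U>" "\<Union>\<U> = UNIV" "\<And>U. U \<in> \<U> \<Longrightarrow> open U" "\<U> \<noteq> {}"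
  using assms by (auto simp: open_covers_def covers_def)

lemma openin_power_word:
  assumes "\<U> \<in> open_covers euclidean" "w \<in> words \<U> n"
  shows "openin (power_topology n) (Pi\<^sub>E {..<n} w)"
proof -
  have "openin euclidean (w i)" if "i \<in> {..<n}" for i
    using assms(2) that open_coversD(4)[OF assms(1)] by (auto simp: words_def open_openin[symmetric])
  then show ?thesis unfolding power_topology_def by (subst openin_PiE) auto
qed

text \<open>A cheapest word at \<open>y\<close> has open letters and so still contains all nearby
  blocks; they can only be cheaper, which is why no error term appears.\<close>

lemma word_cost_usc:
  assumes U: "\<U> \<in> open_covers euclidean"
  shows "\<exists>r>0. \<forall>z. (\<Sum>l<N. dist (z l) (y l)) < r \<longrightarrow> word_cost c \<U> N z \<le> word_cost c \<U> N y"
proof -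
  obtain w where w: "w \<in> words \<U> N" "\<forall>l<N. y l \<in> w l" "word_cost c \<U> N y = c w"
    using word_cost_attained[OF open_coversD(2,3)[OF U], where z = y and N = N and c = c] by metis
  have "restrict y {..<N} \<in> Pi\<^sub>E {..<N} w" using w(2) by simp
  from power_topology_nbhd[OF openin_power_word[OF U w(1)] this]
  obtain r where r: "r > 0" "\<forall>z. (\<Sum>l<N. dist (z l) (y l)) < r \<longrightarrow> restrict z {..<N} \<in> Pi\<^sub>E {..<N} w"
    by blast
  have "word_cost c \<U> N z \<le> word_cost c \<U> N y" if "(\<Sum>l<N. dist (z l) (y l)) < r" for z
  proof -
    have "restrict z {..<N} \<in> Pi\<^sub>E {..<N} w" using r(2) that by blast
    then show ?thesis
      unfolding w(3) by (intro word_cost_le[OF open_coversD(2)[OF U] w(1)]) auto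
  qed
  with r(1) show ?thesis by blast
qed

text \<open>Some offset has at most the average cost \<open>a\<close>, and along it Kraft's
  inequality counts the possible block names. The remaining factors count the offsets and the free
  letters at the at most \<open>2 * N\<close> positions outside the blocks.\<close>

lemma finite_words_cover:
  fixes c :: "(nat \<Rightarrow> 'a set) \<Rightarrow> real"
  assumes U: "finite \<U>" "\<Union>\<U> = UNIV" "\<U> \<noteq> {}" and N: "N \<ge> 1" "N \<le> n"
    and kraft: "(\<Sum>w\<in>words \<U> N. exp (- c w)) \<le> 1"
  defines "m \<equiv> n div N - 1"
  shows "\<exists>W. W \<subseteq> words \<U> n \<and> real (card W) \<le> real N * real (card \<U>) ^ (2 * N) * exp a \<and>
    (\<forall>x. (\<Sum>i<m * N. word_cost c \<U> N (\<lambda>l. x (i + l))) \<le> real N * a \<longrightarrow> (\<exists>w\<in>W. \<forall>i<n. x i \<in> w i))"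
proof -
  have m: "(m + 1) * N \<le> n" "n \<le> m * N + 2 * N"
  proof -
    have "n div N \<ge> 1" using N by (simp add: div_greater_zero_iff Suc_leI)
    then have "m + 1 = n div N" by (simp add: m_def)
    then show "(m + 1) * N \<le> n" by simp
    show "n \<le> m * N + 2 * N" using blocks_fit(2)[OF N(1), of n] by (simp add: m_def)
  qed
  \<comment> \<open>\<open>J j\<close> holds the positions outside the blocks at offset
    \<open>j\<close>, \<open>R\<close> the affordable sequences of block names, and
    \<open>glue\<close> assembles both into one word.\<close>
  define J where "J = (\<lambda>j. {..<n} - {j..<j + m * N})"
  define R where "R = {\<beta> \<in> {..<m} \<rightarrow>\<^sub>E words \<U> N. (\<Sum>k<m. c (\<beta> k)) \<le> a}"
  define glue where "glue = (\<lambda>j (u :: nat \<Rightarrow> 'a set, \<beta> :: nat \<Rightarrow> nat \<Rightarrow> 'a set). \<lambda>i\<in>{..<n}.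
    if i \<in> {j..<j + m * N} then \<beta> ((i - j) div N) ((i - j) mod N) else u i)"
  define W where "W = (\<Union>j<N. glue j ` ((J j \<rightarrow>\<^sub>E \<U>) \<times> R))"
  have finR: "finite R"
    by (rule finite_subset[of _ "{..<m} \<rightarrow>\<^sub>E words \<U> N"])
       (use finite_words[OF U(1), of N] in \<open>simp_all add: R_def finite_PiE\<close>)
  have blockpos: "(i - j) div N < m \<and> (i - j) mod N < N" if "i \<in> {j..<j + m * N}" for i j
    using that N(1) by (auto simp: less_mult_imp_div_less)
  have "W \<subseteq> words \<U> n"
  proof
    fix w assume "w \<in> W"
    then obtain j u \<beta> where w: "u \<in> J j \<rightarrow>\<^sub>E \<U>" "\<beta> \<in> R" "w = glue j (u, \<beta>)"
      unfolding W_def by auto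
    have "w i \<in> \<U>" if i: "i < n" for i
    proof (cases "i \<in> {j..<j + m * N}")
      case True
      with w(2) blockpos[OF True] have "\<beta> ((i - j) div N) \<in> words \<U> N" by (auto simp: R_def)
      then have "\<beta> ((i - j) div N) ((i - j) mod N) \<in> \<U>" using blockpos[OF True] by (auto simp: words_def)
      then show ?thesis using i True by (simp add: w(3) glue_def)
    next
      case False
      then have "i \<in> J j" using i by (simp add: J_def)
      then have "u i \<in> \<U>" using w(1) by auto
      then show ?thesis using i False by (simp only: w(3) glue_def) auto
    qed
    then show "w \<in> words \<U> n" by (auto simp: words_def w(3) glue_def)
  qed
  moreover have "real (card W) \<le> real N * real (card \<U>) ^ (2 * N) * exp a"
  proof -
    have "real (card (glue j ` ((J j \<rightarrow>\<^sub>E \<U>) \<times> R))) \<le> real (card \<U>) ^ (2 * N) * exp a" if "j < N" for j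
    proof -
      have "{j..<j + m * N} \<subseteq> {..<n}" using that m(1) by auto
      then have cJ: "card (J j) = n - m * N" by (simp add: J_def card_Diff_subset)
      have finJ: "finite (J j)" by (simp add: J_def)
      have "card (glue j ` ((J j \<rightarrow>\<^sub>E \<U>) \<times> R)) \<le> card ((J j \<rightarrow>\<^sub>E \<U>) \<times> R)"
        using U(1) finJ finR by (intro card_image_le finite_cartesian_product finite_PiE) auto
      then have "real (card (glue j ` ((J j \<rightarrow>\<^sub>E \<U>) \<times> R))) \<le> real (card \<U>) ^ (n - m * N) * real (card R)"
        using finJ cJ by (simp add: card_cartesian_product card_PiE flip: of_nat_power of_nat_mult)
      also have "\<dots> \<le> real (card \<U>) ^ (2 * N) * exp a"
      proof (rule mult_mono)
        have "card \<U> \<ge> 1" using U(1,3) by (simp add: Suc_leI card_gt_0_iff)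
        then show "real (card \<U>) ^ (n - m * N) \<le> real (card \<U>) ^ (2 * N)"
          using m(2) by (intro power_increasing) auto
        show "real (card R) \<le> exp a"
          unfolding R_def by (rule kraft_count[OF finite_words[OF U(1)] kraft])
      qed auto
      finally show ?thesis .
    qed
    then have "(\<Sum>j<N. real (card (glue j ` ((J j \<rightarrow>\<^sub>E \<U>) \<times> R)))) \<le> (\<Sum>j<N. real (card \<U>) ^ (2 * N) * exp a)"
      by (intro sum_mono) auto
    moreover have "card W \<le> (\<Sum>j<N. card (glue j ` ((J j \<rightarrow>\<^sub>E \<U>) \<times> R)))"
      unfolding W_def by (rule card_UN_le) simp
    then have "real (card W) \<le> (\<Sum>j<N. real (card (glue j ` ((J j \<rightarrow>\<^sub>E \<U>) \<times> R))))"
      by (simp flip: of_nat_sum)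
    ultimately show ?thesis by simp
  qed
  moreover have "\<exists>w\<in>W. \<forall>i<n. x i \<in> w i"
    if x: "(\<Sum>i<m * N. word_cost c \<U> N (\<lambda>l. x (i + l))) \<le> real N * a" for x
  proof -
    let ?C = "\<lambda>i. word_cost c \<U> N (\<lambda>l. x (i + l))"
    \<comment> \<open>Pigeonhole: otherwise all \<open>N\<close> offsets together would cost more
      than \<open>N * a\<close>.\<close>
    have "\<exists>j<N. (\<Sum>k<m. ?C (j + k * N)) \<le> a"
    proof (rule ccontr)
      assume "\<not> (\<exists>j<N. (\<Sum>k<m. ?C (j + k * N)) \<le> a)"
      then have "(\<Sum>j<N. a) < (\<Sum>j<N. \<Sum>k<m. ?C (j + k * N))"
        using N(1) by (intro sum_strict_mono) (auto simp: not_le lessThan_empty_iff)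
      then show False using x by (simp add: sum_offset_blocks)
    qed
    then obtain j where j: "j < N" "(\<Sum>k<m. ?C (j + k * N)) \<le> a" by blast
    have "\<exists>w. w \<in> words \<U> N \<and> (\<forall>l<N. x (j + k * N + l) \<in> w l) \<and> ?C (j + k * N) = c w" for k
      using word_cost_attained[OF U(1,2), where z = "\<lambda>l. x (j + k * N + l)" and N = N and c = c] by metis
    then obtain b where b: "\<And>k. b k \<in> words \<U> N" "\<And>k l. l < N \<Longrightarrow> x (j + k * N + l) \<in> b k l"
      "\<And>k. ?C (j + k * N) = c (b k)" by metis
    have "\<forall>y. \<exists>V. V \<in> \<U> \<and> y \<in> V" using U(2) by blast
    then obtain V where V: "\<And>y. V y \<in> \<U>" "\<And>y. y \<in> V y" by metis
    define u where "u = (\<lambda>i\<in>J j. V (x i))"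
    have "u \<in> J j \<rightarrow>\<^sub>E \<U>" using V by (auto simp: u_def)
    moreover have "restrict b {..<m} \<in> R" using b(1,3) j(2) by (auto simp: R_def)
    ultimately have "glue j (u, restrict b {..<m}) \<in> W" unfolding W_def using j(1) by blast
    moreover have "x i \<in> glue j (u, restrict b {..<m}) i" if i: "i < n" for i
    proof (cases "i \<in> {j..<j + m * N}")
      case True
      then have "x (j + (i - j) div N * N + (i - j) mod N) \<in> b ((i - j) div N) ((i - j) mod N)"
        using blockpos[OF True] by (intro b(2)) auto
      moreover have "j + (i - j) div N * N + (i - j) mod N = i"
        using True by (simp only: add.assoc div_mult_mod_eq) simp
      ultimately show ?thesis using i True blockpos[OF True] by (simp add: glue_def)
    next
      case False
      then show ?thesis using i V(2) by (simp only: glue_def u_def J_def) auto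
    qed
    ultimately show ?thesis by blast
  qed
  ultimately show ?thesis by blast
qed

text \<open>Sub-additivity holds at every offset, so the bounds may be averaged over all of them.
  The sum over all starting points therefore suffices, independently of the offset that is
  favourable for the words.\<close>

lemma block_potential_average_le:
  assumes F: "block_subadditive F" and C: "C \<ge> 0" "\<And>n x. block_potential F n x \<le> real n * C"
    and N: "N \<ge> 1" "N \<le> n"
  shows "block_potential F n x \<le>
    (\<Sum>i<(n div N - 1) * N. block_potential F N (\<lambda>l. x (i + l))) / real N + 2 * real N * C"
proof -
  define m where "m = n div N - 1"
  have m: "(m + 1) * N \<le> n" "n \<le> m * N + 2 * N"
  proof -
    have "n div N \<ge> 1" using N by (simp add: div_greater_zero_iff Suc_leI)
    then have "m + 1 = n div N" by (simp add: m_def)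
    then show "(m + 1) * N \<le> n" by simp
    show "n \<le> m * N + 2 * N" using blocks_fit(2)[OF N(1), of n] by (simp add: m_def)
  qed
  have "block_potential F n x \<le> (\<Sum>k<m. block_potential F N (\<lambda>l. x (j + k * N + l))) + 2 * real N * C"
    if j: "j < N" for j
  proof -
    \<comment> \<open>The head of length \<open>j\<close> and the tail of length \<open>r\<close>
      together have \<open>n - m * N\<close> positions, hence at most \<open>2 * N\<close>.\<close>
    define r where "r = n - m * N - j"
    have n: "n = j + (m * N + r)" using m(1) j by (simp add: r_def)
    have "block_potential F n x \<le> block_potential F j x + block_potential F (m * N + r) (\<lambda>i. x (j + i))"
      unfolding n by (rule block_potential_add[OF F])
    moreover have "block_potential F (m * N + r) (\<lambda>i. x (j + i)) \<le>
        (\<Sum>k<m. block_potential F N (\<lambda>l. x (j + (k * N + l)))) + block_potential F r (\<lambda>l. x (j + (m * N + l)))"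
      by (rule block_potential_blocks[OF F])
    moreover have "block_potential F j x \<le> real j * C" by (rule C(2))
    moreover have "block_potential F r (\<lambda>l. x (j + (m * N + l))) \<le> real r * C" by (rule C(2))
    moreover have "real j * C + real r * C \<le> 2 * real N * C"
    proof -
      have "real j + real r \<le> 2 * real N" using m(2) n by linarith
      then show ?thesis using C(1) by (metis distrib_right mult_right_mono)
    qed
    ultimately show ?thesis by (simp add: add.assoc)
  qed
  then have "(\<Sum>j<N. block_potential F n x) \<le>
      (\<Sum>j<N. (\<Sum>k<m. block_potential F N (\<lambda>l. x (j + k * N + l))) + 2 * real N * C)"
    by (intro sum_mono) auto
  then have "real N * block_potential F n x \<le>
      (\<Sum>i<m * N. block_potential F N (\<lambda>l. x (i + l))) + real N * (2 * real N * C)"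
    by (simp add: sum.distrib sum_offset_blocks)
  then have "block_potential F n x \<le>
      ((\<Sum>i<m * N. block_potential F N (\<lambda>l. x (i + l))) + real N * (2 * real N * C)) / real N"
    using N(1) by (simp add: pos_le_divide_eq mult.commute)
  then show ?thesis using N(1) by (simp add: m_def add_divide_distrib)
qed

section \<open>From word counts to pressure\<close>

context invariant_system
begin

lemma topspace_generic [simp]:
  "topspace (subtopology (power_topology n) (generic_pseudo_orbits S n \<delta> \<mu> L)) = generic_pseudo_orbits S n \<delta> \<mu> L"
  by (auto simp: generic_pseudo_orbits_def avg_pseudo_orbits_def)

text \<open>The boxes of the words in \<open>W\<close>, cut down to the generic pseudo-orbits, form
  an admissible cover, and each supremum is at most \<open>exp b\<close>. Different words may cut
  out the same set, which only lowers the sum.\<close>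

lemma GP_n_le:
  assumes U: "\<U> \<in> open_covers euclidean" and W: "W \<subseteq> words \<U> n"
    and cov: "\<And>x. x \<in> generic_pseudo_orbits S n \<delta> \<mu> L \<Longrightarrow> \<exists>w\<in>W. \<forall>i<n. x i \<in> w i"
    and b: "\<And>x. x \<in> generic_pseudo_orbits S n \<delta> \<mu> L \<Longrightarrow> F n x \<le> b"
  shows "GP_n S F \<U> n \<delta> \<mu> L \<le> ennreal (real (card W) * exp b)"
proof -
  define K where "K = generic_pseudo_orbits S n \<delta> \<mu> L"
  define \<V> where "\<V> = (\<lambda>w. K \<inter> Pi\<^sub>E {..<n} w) ` W"
  let ?X = "subtopology (power_topology n) K"
  have finW: "finite W" using W finite_words[OF open_coversD(2)[OF U]] by (rule finite_subset)
  have K: "K \<subseteq> {..<n} \<rightarrow>\<^sub>E UNIV" "topspace ?X = K"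
    by (auto simp: K_def generic_pseudo_orbits_def avg_pseudo_orbits_def)
  have "\<V> \<in> covers ?X"
    unfolding covers_def
  proof (intro CollectI conjI)
    show "finite \<V>" using finW by (simp add: \<V>_def)
    have "openin ?X (K \<inter> Pi\<^sub>E {..<n} w)" if "w \<in> W" for w
      using openin_power_word[OF U] W that by (intro openin_subtopology_Int2) auto
    then show "\<V> \<subseteq> borel_subsets ?X"
      unfolding \<V>_def borel_subsets_def by (auto intro: sigma_sets.Basic)
    have "x \<in> \<Union>\<V>" if "x \<in> K" for x
    proof -
      have "\<exists>w\<in>W. \<forall>i<n. x i \<in> w i" using cov that by (simp add: K_def)
      then obtain w where "w \<in> W" "\<forall>i<n. x i \<in> w i" by blast
      moreover have "x \<in> extensional {..<n}" using that K(1) by (auto simp: PiE_def)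
      ultimately show ?thesis using that by (auto simp: \<V>_def PiE_def)
    qed
    then show "\<Union>\<V> = topspace ?X" unfolding K(2) by (auto simp: \<V>_def)
  qed
  moreover have "finer \<V> (cover_power \<U> n)"
    unfolding finer_def
  proof
    fix V assume "V \<in> \<V>"
    then obtain w where w: "w \<in> W" "V = K \<inter> Pi\<^sub>E {..<n} w" by (auto simp: \<V>_def)
    then have "Pi\<^sub>E {..<n} w \<in> cover_power \<U> n" using W unfolding cover_power_def words_def by blast
    then show "\<exists>P\<in>cover_power \<U> n. V \<subseteq> P" using w(2) by blast
  qed
  ultimately have "GP_n S F \<U> n \<delta> \<mu> L \<le> (\<Sum>V\<in>\<V>. SUP x\<in>V. ennreal (exp (F n x)))"
    unfolding GP_n_def Let_def K_def[symmetric] by (intro INF_lower) auto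
  also have "\<dots> \<le> (\<Sum>V\<in>\<V>. ennreal (exp b))"
  proof (intro sum_mono SUP_least)
    fix V x assume "V \<in> \<V>" "x \<in> V"
    then have "x \<in> K" by (auto simp: \<V>_def)
    then show "ennreal (exp (F n x)) \<le> ennreal (exp b)" using b by (simp add: K_def ennreal_leI)
  qed
  also have "\<dots> = ennreal (real (card \<V>) * exp b)" by (simp add: ennreal_mult ennreal_of_nat_eq_real_of_nat)
  also have "\<dots> \<le> ennreal (real (card W) * exp b)"
    using card_image_le[OF finW] by (intro ennreal_leI mult_right_mono) (auto simp: \<V>_def)
  finally show ?thesis .
qed

text \<open>
  The term ln 2 is the price for mixing the distribution given by the partition with the uniform
  one, which makes the code length of every word finite.
\<close>

lemma word_code_exists:
  assumes U: "\<U> \<in> open_covers euclidean" and \<alpha>: "\<alpha> \<in> partitions euclidean" "finer \<alpha> (iterated_join S \<U> N)"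
  shows "\<exists>c. (\<Sum>w\<in>words \<U> N. exp (- c w)) \<le> 1 \<and>
    (\<integral>y. word_cost c \<U> N (\<lambda>l. (S ^^ l) y) \<partial>\<mu>) \<le> partition_entropy \<mu> \<alpha> + ln 2"
proof -
  \<comment> \<open>Fixing one word for each member of \<open>\<alpha>\<close> pushes the measure
    forward to a distribution on words.\<close>
  have "\<exists>w\<in>words \<U> N. A \<subseteq> itinerary S N w" if "A \<in> \<alpha>" for A
    using \<alpha>(2) that by (auto simp: finer_def iterated_join_eq words_def)
  then obtain wd where wd: "\<And>A. A \<in> \<alpha> \<Longrightarrow> wd A \<in> words \<U> N" "\<And>A. A \<in> \<alpha> \<Longrightarrow> A \<subseteq> itinerary S N (wd A)"
    by metis
  have fin\<alpha>: "finite \<alpha>" and meas: "\<And>A. A \<in> \<alpha> \<Longrightarrow> A \<in> sets borel" and un: "\<Union>\<alpha> = UNIV"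
    and disj: "disjoint_family_on (\<lambda>A. A) \<alpha>"
    using \<alpha>(1) by (auto simp: partitions_euclidean_iff disjoint_family_on_def pairwise_def disjnt_def)
  have finW: "finite (words \<U> N)" by (rule finite_words[OF open_coversD(2)[OF U]])
  have "words \<U> N \<noteq> {}" using wd(1) un by (metis UNIV_I UnionE empty_iff)
  then have cW: "card (words \<U> N) > 0" using finW by (simp add: card_gt_0_iff)
  define Q where "Q = (\<lambda>w. (\<Sum>A\<in>{A\<in>\<alpha>. wd A = w}. prob A) / 2 + 1 / (2 * real (card (words \<U> N))))"
  define c where "c = (\<lambda>w. - ln (Q w))"
  have Q_pos: "Q w > 0" for w
    using cW by (auto simp: Q_def intro!: add_nonneg_pos sum_nonneg)
  have Q_ge: "prob A / 2 \<le> Q (wd A)" if "A \<in> \<alpha>" for A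
  proof -
    have "prob A \<le> (\<Sum>A'\<in>{A'\<in>\<alpha>. wd A' = wd A}. prob A')"
      using that fin\<alpha> by (intro member_le_sum) auto
    moreover have "1 / (2 * real (card (words \<U> N))) \<ge> 0" by simp
    ultimately show ?thesis unfolding Q_def by linarith
  qed
  have "(\<Sum>w\<in>words \<U> N. \<Sum>A\<in>{A\<in>\<alpha>. wd A = w}. prob A) = (\<Sum>A\<in>\<alpha>. prob A)"
    using wd(1) fin\<alpha> finW by (intro sum.group) auto
  also have "\<dots> = 1"
    using sum_prob_Int[OF fin\<alpha> meas disj, of UNIV] un prob_space by simp
  finally have "(\<Sum>w\<in>words \<U> N. Q w) = 1 / 2 + real (card (words \<U> N)) * (1 / (2 * real (card (words \<U> N))))"
    by (simp add: Q_def sum.distrib flip: sum_divide_distrib)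
  also have "\<dots> = 1" using cW by simp
  finally have kraft: "(\<Sum>w\<in>words \<U> N. exp (- c w)) \<le> 1" using Q_pos by (simp add: c_def)
  let ?o = "\<lambda>y. word_cost c \<U> N (\<lambda>l. (S ^^ l) y)"
  have int: "integrable \<mu> ?o"
  proof (rule upper_regularization(1)[where N = N])
    show "\<bar>word_cost c \<U> N z\<bar> \<le> (\<Sum>w\<in>words \<U> N. \<bar>c w\<bar>)" for z
      by (rule word_cost_bounded[OF open_coversD(2,3)[OF U]])
    fix y and \<epsilon> :: real assume "\<epsilon> > 0"
    then show "\<exists>r>0. \<forall>z. (\<Sum>l<N. dist (z l) ((S ^^ l) y)) < r \<longrightarrow> word_cost c \<U> N z \<le> ?o y + \<epsilon>"
      using word_cost_usc[OF U, where N = N and y = "\<lambda>l. (S ^^ l) y" and c = c] by (meson add_increasing2 less_imp_le order_trans)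
  qed
  \<comment> \<open>The word attached to the member containing \<open>y\<close> is one admissible
    name of the orbit block, so the cheapest name costs no more.\<close>
  have pw: "?o y \<le> (\<Sum>A\<in>\<alpha>. indicator A y * c (wd A))" for y
  proof -
    obtain A where A: "A \<in> \<alpha>" "y \<in> A" using un by blast
    have "indicator A' y = (if A' = A then 1 else 0 :: real)" if "A' \<in> \<alpha>" for A'
      using disj A that by (auto simp: disjoint_family_on_def indicator_def)
    then have "(\<Sum>A'\<in>\<alpha>. indicator A' y * c (wd A')) = (\<Sum>A'\<in>\<alpha>. if A' = A then c (wd A') else 0)"
      by (intro sum.cong) auto
    also have "\<dots> = c (wd A)" using A(1) fin\<alpha> by simp
    finally show ?thesis
      using word_cost_le[OF open_coversD(2)[OF U] wd(1)[OF A(1)], where z = "\<lambda>l. (S ^^ l) y" and c = c] wd(2)[OF A(1)] A(2)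
      by (auto simp: itinerary_def)
  qed
  have int_ind: "integrable \<mu> (\<lambda>y. indicator A y * c (wd A))" if "A \<in> \<alpha>" for A
    using meas[OF that] by (intro integrable_mult_left integrable_real_indicator) (auto simp: emeasure_eq_measure)
  have "(\<integral>y. ?o y \<partial>\<mu>) \<le> (\<integral>y. (\<Sum>A\<in>\<alpha>. indicator A y * c (wd A)) \<partial>\<mu>)"
    using int int_ind pw by (intro integral_mono) auto
  also have "\<dots> = (\<Sum>A\<in>\<alpha>. prob A * c (wd A))"
    using int_ind meas by (subst Bochner_Integration.integral_sum) auto
  also have "\<dots> \<le> (\<Sum>A\<in>\<alpha>. prob A * ln 2 - prob A * ln (prob A))"
  proof (rule sum_mono)
    fix A assume A: "A \<in> \<alpha>"
    show "prob A * c (wd A) \<le> prob A * ln 2 - prob A * ln (prob A)"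
    proof (cases "prob A = 0")
      case False
      then have p: "prob A > 0" by (simp add: zero_less_measure_iff)
      then have "ln (prob A / 2) \<le> ln (Q (wd A))" using Q_ge[OF A] by (intro ln_mono) auto
      then have "c (wd A) \<le> ln 2 - ln (prob A)" using p by (simp add: c_def ln_div)
      then show ?thesis using p by (simp flip: right_diff_distrib)
    qed simp
  qed
  also have "\<dots> = (\<Sum>A\<in>\<alpha>. prob A) * ln 2 + partition_entropy \<mu> \<alpha>"
    by (simp add: sum_subtractf partition_entropy_def sum_distrib_right)
  also have "(\<Sum>A\<in>\<alpha>. prob A) = 1" by fact
  finally show ?thesis using kraft by (intro exI[of _ c]) simp
qed


lemma prob_UNIV [simp]: "prob UNIV = 1"
  using prob_space by simp

lemma eventually_le_of_limits:
  assumes U: "\<U> \<in> open_covers euclidean" and F: "block_subadditive F"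
    and P: "potential_mean \<mu> (induced_potential S F) = ereal P" and \<epsilon>: "\<epsilon> > 0"
  obtains N where "N \<ge> 1" "cover_entropy \<mu> (iterated_join S \<U> N) / real N < local_entropy \<mu> S \<U> + \<epsilon>"
    "mean_block_potential F N / real N < P + \<epsilon>" "ln 2 / real N < \<epsilon>"
proof -
  have "(\<lambda>n. mean_block_potential F n / real n) \<longlonglongrightarrow> P"
    using potential_mean_tendsto(1)[OF F] by (simp add: P)
  then have "\<forall>\<^sub>F n in sequentially. mean_block_potential F n / real n < P + \<epsilon>"
    using \<epsilon> by (intro order_tendstoD(2)) auto
  moreover have "\<forall>\<^sub>F n in sequentially.
      cover_entropy \<mu> (iterated_join S \<U> n) / real n < local_entropy \<mu> S \<U> + \<epsilon>"
    using local_entropy_tendsto[OF open_coversD(1)[OF U]] \<epsilon> by (intro order_tendstoD(2)) auto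
  moreover have "\<forall>\<^sub>F n in sequentially. ln 2 / real n < \<epsilon>"
    using lim_const_over_n[of "ln 2 :: real"] \<epsilon> by (intro order_tendstoD(2)) auto
  ultimately have "\<forall>\<^sub>F n in sequentially. n \<ge> 1 \<and>
      cover_entropy \<mu> (iterated_join S \<U> n) / real n < local_entropy \<mu> S \<U> + \<epsilon> \<and>
      mean_block_potential F n / real n < P + \<epsilon> \<and> ln 2 / real n < \<epsilon>"
    using eventually_ge_at_top[of 1] by eventually_elim simp
  from eventually_happens'[OF sequentially_bot this] obtain N where
    "N \<ge> 1 \<and> cover_entropy \<mu> (iterated_join S \<U> N) / real N < local_entropy \<mu> S \<U> + \<epsilon> \<and>
      mean_block_potential F N / real N < P + \<epsilon> \<and> ln 2 / real N < \<epsilon>" ..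
  then show ?thesis by (intro that[of N]) simp_all
qed

lemma GP_delta_le:
  assumes U: "\<U> \<in> open_covers euclidean" and F: "block_subadditive F"
    and P: "potential_mean \<mu> (induced_potential S F) = ereal P" and \<epsilon>: "\<epsilon> > 0"
  shows "\<exists>L \<delta>. finite L \<and> (\<forall>g\<in>L. continuous_on UNIV g) \<and> \<delta> > 0 \<and>
    GP_delta S F \<U> \<delta> \<mu> L \<le> ereal (local_entropy \<mu> S \<U> + P + 7 * \<epsilon>)"
proof -
  let ?h = "local_entropy \<mu> S \<U>"
  obtain N where N: "N \<ge> 1" "cover_entropy \<mu> (iterated_join S \<U> N) / real N < ?h + \<epsilon>"
    "mean_block_potential F N / real N < P + \<epsilon>" "ln 2 / real N < \<epsilon>"
    using eventually_le_of_limits[OF U F P \<epsilon>] .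
  obtain \<alpha> where \<alpha>: "\<alpha> \<in> partitions euclidean" "finer \<alpha> (iterated_join S \<U> N)"
    "partition_entropy \<mu> \<alpha> < cover_entropy \<mu> (iterated_join S \<U> N) + \<epsilon>"
    using cover_entropy_approx[OF iterated_join_covers[OF open_coversD(1)[OF U]] \<epsilon>] .
  obtain c where c: "(\<Sum>w\<in>words \<U> N. exp (- c w)) \<le> 1"
    "(\<integral>y. word_cost c \<U> N (\<lambda>l. (S ^^ l) y) \<partial>\<mu>) \<le> partition_entropy \<mu> \<alpha> + ln 2"
    using word_code_exists[OF U \<alpha>(1,2)] by blast
  let ?c = "\<integral>y. word_cost c \<U> N (\<lambda>l. (S ^^ l) y) \<partial>\<mu>" and ?f = "mean_block_potential F N"
  have "\<exists>g \<delta> C. continuous_on UNIV g \<and> \<delta> > 0 \<and> (\<forall>n\<ge>2. \<forall>x\<in>generic_pseudo_orbits S n \<delta> \<mu> {g}.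
    (\<Sum>i<(n div N - 1) * N. word_cost c \<U> N (\<lambda>l. x (i + l))) \<le> real n * (?c + \<epsilon>) + C)"
  proof (rule sum_blocks_le_generic[where N = N, OF _ _ N(1) \<epsilon>])
    show "\<bar>word_cost c \<U> N z\<bar> \<le> (\<Sum>w\<in>words \<U> N. \<bar>c w\<bar>)" for z
      by (rule word_cost_bounded[OF open_coversD(2,3)[OF U]])
    fix y and e :: real assume "e > 0"
    then show "\<exists>r>0. \<forall>z. (\<Sum>l<N. dist (z l) ((S ^^ l) y)) < r \<longrightarrow>
        word_cost c \<U> N z \<le> word_cost c \<U> N (\<lambda>l. (S ^^ l) y) + e"
      using word_cost_usc[OF U, where N = N and y = "\<lambda>l. (S ^^ l) y" and c = c]
      by (meson add_increasing2 less_imp_le order_trans)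
  qed
  then obtain g1 \<delta>1 C1 where 1: "continuous_on UNIV g1" "\<delta>1 > 0"
    "\<And>n x. n \<ge> 2 \<Longrightarrow> x \<in> generic_pseudo_orbits S n \<delta>1 \<mu> {g1} \<Longrightarrow>
      (\<Sum>i<(n div N - 1) * N. word_cost c \<U> N (\<lambda>l. x (i + l))) \<le> real n * (?c + \<epsilon>) + C1" by blast
  obtain B where B: "\<And>x. \<bar>block_potential F N x\<bar> \<le> B"
    using block_potential_bounded[OF compact_UNIV F] by metis
  have "\<exists>g \<delta> C. continuous_on UNIV g \<and> \<delta> > 0 \<and> (\<forall>n\<ge>2. \<forall>x\<in>generic_pseudo_orbits S n \<delta> \<mu> {g}.
    (\<Sum>i<(n div N - 1) * N. block_potential F N (\<lambda>l. x (i + l))) \<le> real n * (?f + \<epsilon>) + C)"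
    unfolding mean_block_potential_def
    by (rule sum_blocks_le_generic[where N = N, OF B _ N(1) \<epsilon>]) (rule block_potential_usc[OF F])
  then obtain g2 \<delta>2 C2 where 2: "continuous_on UNIV g2" "\<delta>2 > 0"
    "\<And>n x. n \<ge> 2 \<Longrightarrow> x \<in> generic_pseudo_orbits S n \<delta>2 \<mu> {g2} \<Longrightarrow>
      (\<Sum>i<(n div N - 1) * N. block_potential F N (\<lambda>l. x (i + l))) \<le> real n * (?f + \<epsilon>) + C2" by blast
  obtain D where D: "D \<ge> 0" "\<And>n x. block_potential F n x \<le> real n * D"
    using block_potential_linear_bound[OF compact_UNIV F] by blast
  \<comment> \<open>One test function controls the code length and one the potential; the smaller
    tolerance serves both.\<close>
  define L \<delta> where "L = {g1, g2}" and "\<delta> = min \<delta>1 \<delta>2"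
  define R where "R = ln (real N * real (card \<U>) ^ (2 * N)) + C1 / real N + C2 / real N + 2 * real N * D"
  have cU: "card \<U> > 0" using open_coversD(2,5)[OF U] by (simp add: card_gt_0_iff)
  have NU: "real N * real (card \<U>) ^ (2 * N) > 0" using N(1) cU by simp
  \<comment> \<open>Four of the six \<open>\<epsilon>\<close> come from the words (limit, partition,
    \<open>ln 2\<close>, regularisation) and two from the potential (limit, regularisation). The
    seventh in the conclusion absorbs \<open>R / n\<close>.\<close>
  have slope: "(?c + \<epsilon>) / real N + (?f + \<epsilon>) / real N \<le> ?h + P + 6 * \<epsilon>"
  proof -
    have "(?c + \<epsilon>) / real N \<le> (cover_entropy \<mu> (iterated_join S \<U> N) + ln 2 + 2 * \<epsilon>) / real N"
      using c(2) \<alpha>(3) by (intro divide_right_mono) auto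
    moreover have "\<epsilon> / real N \<le> \<epsilon> / 1" using N(1) \<epsilon> by (intro divide_left_mono) auto
    ultimately show ?thesis using N(2-4) by (simp add: add_divide_distrib)
  qed
  have bound: "ext_log (GP_n S F \<U> n \<delta> \<mu> L) / ereal (real n) \<le> ereal (?h + P + 6 * \<epsilon> + R / real n)"
    if n: "n \<ge> 2" "n \<ge> N" for n
  proof -
    \<comment> \<open>Chosen so that \<open>real N * a\<close> is exactly the bound on the summed
      code lengths; \<open>b\<close> is the matching bound for the potential plus the cost of the
      ends.\<close>
    define a where "a = (real n * (?c + \<epsilon>) + C1) / real N"
    define b where "b = (real n * (?f + \<epsilon>) + C2) / real N + 2 * real N * D"
    let ?K = "generic_pseudo_orbits S n \<delta> \<mu> L"
    obtain W where W: "W \<subseteq> words \<U> n" "real (card W) \<le> real N * real (card \<U>) ^ (2 * N) * exp a"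
      "\<And>x. (\<Sum>i<(n div N - 1) * N. word_cost c \<U> N (\<lambda>l. x (i + l))) \<le> real N * a \<Longrightarrow> (\<exists>w\<in>W. \<forall>i<n. x i \<in> w i)"
      using finite_words_cover[OF open_coversD(2,3,5)[OF U] N(1) n(2) c(1), of a] by blast
    have "GP_n S F \<U> n \<delta> \<mu> L \<le> ennreal (real (card W) * exp b)"
    proof (rule GP_n_le[OF U W(1)])
      fix x assume x: "x \<in> ?K"
      have "x \<in> generic_pseudo_orbits S n \<delta>1 \<mu> {g1}"
        using generic_pseudo_orbits_mono[of \<delta> \<delta>1 "{g1}" L n] x by (auto simp: L_def \<delta>_def)
      from 1(3)[OF n(1) this]
      have "(\<Sum>i<(n div N - 1) * N. word_cost c \<U> N (\<lambda>l. x (i + l))) \<le> real N * a"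
        using N(1) by (simp add: a_def)
      then show "\<exists>w\<in>W. \<forall>i<n. x i \<in> w i" by (rule W(3))
      have "x \<in> generic_pseudo_orbits S n \<delta>2 \<mu> {g2}"
        using generic_pseudo_orbits_mono[of \<delta> \<delta>2 "{g2}" L n] x by (auto simp: L_def \<delta>_def)
      from 2(3)[OF n(1) this]
      have "(\<Sum>i<(n div N - 1) * N. block_potential F N (\<lambda>l. x (i + l))) / real N \<le>
          (real n * (?f + \<epsilon>) + C2) / real N" by (rule divide_right_mono) simp
      then have "block_potential F n x \<le> b"
        using block_potential_average_le[OF F D N(1) n(2), of x] by (simp add: b_def)
      moreover have "restrict x {..<n} = x"
        using x by (auto simp: generic_pseudo_orbits_def avg_pseudo_orbits_def PiE_restrict)
      ultimately show "F n x \<le> b" using n(1) by (simp add: block_potential_def)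
    qed
    also have "\<dots> \<le> ennreal (real N * real (card \<U>) ^ (2 * N) * exp a * exp b)"
      using W(2) by (intro ennreal_leI mult_right_mono) auto
    also have "real N * real (card \<U>) ^ (2 * N) * exp a * exp b =
        exp (ln (real N * real (card \<U>) ^ (2 * N)) + a + b)"
      using NU by (simp only: exp_add exp_ln)
    also have "ln (real N * real (card \<U>) ^ (2 * N)) + a + b =
        real n * ((?c + \<epsilon>) / real N + (?f + \<epsilon>) / real N) + R"
      by (simp add: a_def b_def R_def add_divide_distrib distrib_left)
    finally have "ext_log (GP_n S F \<U> n \<delta> \<mu> L) \<le>
        ereal (real n * ((?c + \<epsilon>) / real N + (?f + \<epsilon>) / real N) + R)"
      by (rule ext_log_le)
    also have "\<dots> \<le> ereal (real n * (?h + P + 6 * \<epsilon>) + R)"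
      using mult_left_mono[OF slope, of "real n"] by simp
    finally have "ext_log (GP_n S F \<U> n \<delta> \<mu> L) / ereal (real n) \<le>
        ereal (real n * (?h + P + 6 * \<epsilon>) + R) / ereal (real n)"
      using n by (intro ereal_divide_right_mono) auto
    also have "\<dots> = ereal (?h + P + 6 * \<epsilon> + R / real n)"
      using n by (simp add: add_divide_distrib)
    finally show ?thesis .
  qed
  have "\<forall>\<^sub>F n in sequentially. R / real n < \<epsilon>"
    using lim_const_over_n[of R] \<epsilon> by (intro order_tendstoD(2)) auto
  then have "\<forall>\<^sub>F n in sequentially. ext_log (GP_n S F \<U> n \<delta> \<mu> L) / ereal (real n) \<le> ereal (?h + P + 7 * \<epsilon>)"
    using eventually_ge_at_top[of "max 2 N"]
  proof eventually_elim
    case (elim n)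
    then have "ereal (?h + P + 6 * \<epsilon> + R / real n) \<le> ereal (?h + P + 7 * \<epsilon>)" by simp
    with bound[of n] elim(2) show ?case by (auto intro: order_trans)
  qed
  then have "GP_delta S F \<U> \<delta> \<mu> L \<le> ereal (?h + P + 7 * \<epsilon>)"
    unfolding GP_delta_def by (rule Limsup_bounded)
  moreover have "finite L" "\<forall>g\<in>L. continuous_on UNIV g" "\<delta> > 0"
    using 1(1,2) 2(1,2) by (auto simp: L_def \<delta>_def)
  ultimately show ?thesis by blast
qed

lemma GP_le:
  assumes U: "\<U> \<in> open_covers euclidean" and F: "block_subadditive F"
    and P: "potential_mean \<mu> (induced_potential S F) = ereal P"
  shows "GP S F \<U> \<mu> \<le> ereal (local_entropy \<mu> S \<U> + P)"
proof (rule ereal_le_epsilon2)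
  fix e :: real assume "e > 0"
  then have "e / 7 > 0" by simp
  from GP_delta_le[OF U F P this] obtain L \<delta> where L: "finite L \<and> (\<forall>g\<in>L. continuous_on UNIV g)" "\<delta> > 0"
    "GP_delta S F \<U> \<delta> \<mu> L \<le> ereal (local_entropy \<mu> S \<U> + P + 7 * (e / 7))" by blast
  have "GP S F \<U> \<mu> \<le> GP_delta S F \<U> \<delta> \<mu> L"
    unfolding GP_def using L(1,2) by (intro INF_lower2[of L] INF_lower) auto
  also note L(3)
  finally show "GP S F \<U> \<mu> \<le> ereal (local_entropy \<mu> S \<U> + P) + ereal e" by simp
qed

section \<open>The lower bound for ergodic measures\<close>

text \<open>\<open>max_birkhoff f n\<close> is the maximum of the Birkhoff sums of f of length at most n.\<close>

primrec max_birkhoff :: "('a \<Rightarrow> real) \<Rightarrow> nat \<Rightarrow> 'a \<Rightarrow> real" where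
  "max_birkhoff f 0 = (\<lambda>_. 0)"
| "max_birkhoff f (Suc n) = (\<lambda>y. max 0 (f y + max_birkhoff f n (S y)))"

section \<open>The maximal inequality and Birkhoff averages\<close>

lemma max_birkhoff_nonneg: "max_birkhoff f n y \<ge> 0"
  by (cases n) auto

lemma max_birkhoff_mono: "max_birkhoff f n y \<le> max_birkhoff f (Suc n) y"
proof (induction n arbitrary: y)
  case (Suc n)
  have "f y + max_birkhoff f n (S y) \<le> f y + max_birkhoff f (Suc n) (S y)"
    using Suc[of "S y"] by (rule add_left_mono)
  then show ?case unfolding max_birkhoff.simps(2)[of f "Suc n"] max_birkhoff.simps(2)[of f n]
    by (rule max.mono[OF order_refl])
qed simp

lemma birkhoff_sum_Suc: "(\<Sum>i<Suc n. f ((S ^^ i) y)) = f y + (\<Sum>i<n. f ((S ^^ i) (S y)))"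
  by (subst sum.lessThan_Suc_shift) (simp add: funpow_swap1)

lemma birkhoff_sum_le_max: "(\<Sum>i<n. f ((S ^^ i) y)) \<le> max_birkhoff f n y"
proof (induction n arbitrary: y)
  case (Suc n)
  show ?case unfolding birkhoff_sum_Suc using Suc[of "S y"] by simp
qed simp

lemma continuous_max_birkhoff:
  assumes "continuous_on UNIV f"
  shows "continuous_on UNIV (max_birkhoff f n)"
proof (induction n)
  case (Suc n)
  have "continuous_on UNIV (\<lambda>y. max_birkhoff f n (S y))"
    using continuous_on_compose2[OF Suc, of UNIV S] tds by (simp add: tds_def)
  then show ?case using assms by (auto intro!: continuous_intros)
qed simp

text \<open>Garsia's proof of the maximal ergodic theorem: the recursion bounds the maximum by
  \<open>f\<close> on the positivity set plus a shorter maximum at \<open>S y\<close>. By invariance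
  and monotonicity in length, the two maxima cancel in favour of \<open>f\<close>.\<close>

lemma integral_positive_max_birkhoff:
  assumes f: "continuous_on UNIV f"
  shows "(\<integral>y. indicator {y. max_birkhoff f n y > 0} y * f y \<partial>\<mu>) \<ge> 0"
proof (cases n)
  case (Suc k)
  let ?A = "{y. max_birkhoff f (Suc k) y > 0}"
  have int: "integrable \<mu> (max_birkhoff f m)" for m
    by (rule integrable_continuous[OF continuous_max_birkhoff[OF f]])
  have meas: "max_birkhoff f m \<in> borel_measurable borel" for m
    by (rule borel_measurable_continuous_onI[OF continuous_max_birkhoff[OF f]])
  have "continuous_on UNIV (\<lambda>y. max_birkhoff f k (S y))"
    using continuous_on_compose2[OF continuous_max_birkhoff[OF f], of UNIV S k] tds by (simp add: tds_def)
  then have intS: "integrable \<mu> (\<lambda>y. max_birkhoff f k (S y))" by (rule integrable_continuous)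
  have "open ?A"
    using continuous_max_birkhoff[OF f, of "Suc k"] by (intro open_Collect_less) auto
  then have "?A \<in> sets \<mu>" by simp
  then have intA: "integrable \<mu> (\<lambda>y. indicator ?A y * f y)"
    using integrable_real_mult_indicator[OF _ integrable_continuous[OF f]] by (simp add: mult.commute)
  \<comment> \<open>On \<open>?A\<close> this is an equality by the recursion; off \<open>?A\<close>
    the left side is 0 and the right side nonnegative.\<close>
  have "max_birkhoff f (Suc k) y \<le> indicator ?A y * f y + max_birkhoff f k (S y)" for y
    using max_birkhoff_nonneg[of f k "S y"] by (auto simp: indicator_def max_def split: if_splits)
  then have "(\<integral>y. max_birkhoff f (Suc k) y \<partial>\<mu>) \<le> (\<integral>y. indicator ?A y * f y + max_birkhoff f k (S y) \<partial>\<mu>)"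
    using int intA intS by (intro integral_mono Bochner_Integration.integrable_add)
  also have "\<dots> = (\<integral>y. indicator ?A y * f y \<partial>\<mu>) + (\<integral>y. max_birkhoff f k (S y) \<partial>\<mu>)"
    by (rule Bochner_Integration.integral_add[OF intA intS])
  also have "(\<integral>y. max_birkhoff f k (S y) \<partial>\<mu>) = (\<integral>y. max_birkhoff f k y \<partial>\<mu>)"
    using integral_iterate[OF meas, of k 1] by simp
  also have "\<dots> \<le> (\<integral>y. max_birkhoff f (Suc k) y \<partial>\<mu>)"
    by (intro integral_mono int max_birkhoff_mono)
  finally show ?thesis by (simp add: Suc del: max_birkhoff.simps)
qed simp

text \<open>By ergodicity the sums are unbounded above almost everywhere or almost nowhere. In the
  first case the sets of the maximal inequality exhaust almost all of the space, so the limit of the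
  inequality contradicts the negative mean.\<close>

lemma birkhoff_sums_bounded_above:
  fixes f :: "'a \<Rightarrow> real"
  assumes erg: "ergodic_prob S \<mu>" and f: "continuous_on UNIV f" and neg: "(\<integral>y. f y \<partial>\<mu>) < 0"
  shows "AE y in \<mu>. \<exists>K. \<forall>n. (\<Sum>i<n. f ((S ^^ i) y)) \<le> K"
proof -
  let ?s = "\<lambda>n y. \<Sum>i<n. f ((S ^^ i) y)"
  \<comment> \<open>Unlike the set where the upper limit of the averages is positive, this set is visibly invariant.\<close>
  define E where "E = {y. \<forall>k::nat. \<exists>n. ?s n y > real k}"
  have [measurable]: "f \<in> borel_measurable borel" by (rule borel_measurable_continuous_onI[OF f])
  have "{y \<in> space borel. \<forall>k::nat. \<exists>n. ?s n y > real k} \<in> sets borel" by measurable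
  then have E_sets: "E \<in> sets borel" by (simp add: E_def)
  obtain B where B: "\<And>y. \<bar>f y\<bar> \<le> B" using continuous_bounded[OF f] by metis
  \<comment> \<open>The sums at \<open>y\<close> and at \<open>S y\<close> differ by a shift of
    length and by \<open>f y\<close>, which is bounded by \<open>B\<close>.\<close>
  have "S y \<in> E \<longleftrightarrow> y \<in> E" for y
  proof
    assume Sy: "S y \<in> E"
    show "y \<in> E"
      unfolding E_def
    proof (intro CollectI allI)
      fix k :: nat
      obtain k' :: nat where "real k' > real k + B" using reals_Archimedean2 by blast
      moreover obtain n where "?s n (S y) > real k'" using Sy unfolding E_def by blast
      ultimately have "?s (Suc n) y > real k"
        unfolding birkhoff_sum_Suc using B[of y] by linarith
      then show "\<exists>n. ?s n y > real k" by blast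
    qed
  next
    assume y: "y \<in> E"
    show "S y \<in> E"
      unfolding E_def
    proof (intro CollectI allI)
      fix k :: nat
      obtain k' :: nat where k': "real k' > real k + B" using reals_Archimedean2 by blast
      obtain n where n: "?s n y > real k'" using y unfolding E_def by blast
      then obtain m where m: "n = Suc m" by (cases n) auto
      have "?s m (S y) > real k"
        using n k' B[of y] unfolding m birkhoff_sum_Suc by linarith
      then show "\<exists>n. ?s n (S y) > real k" by blast
    qed
  qed
  then have "S -` E = E" by auto
  then consider "prob E = 0" | "prob E = 1"
    using erg E_sets by (auto simp: ergodic_prob_def)
  then show ?thesis
  proof cases
    case 1
    then have "AE y in \<mu>. y \<notin> E"
      using E_sets by (intro AE_not_in) (auto simp: null_sets_def emeasure_eq_measure)
    then show ?thesis by (rule AE_mp) (auto simp: E_def not_less intro!: AE_I2)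
  next
    case 2
    then have AE_E: "AE y in \<mu>. y \<in> E" using E_sets by (subst AE_in_set_eq_1) auto
    let ?A = "\<lambda>n. {y. max_birkhoff f n y > 0}"
    have meas: "?A n \<in> sets borel" for n
      using continuous_max_birkhoff[OF f, of n] by (intro borel_open open_Collect_less) auto
    have "(\<lambda>n. \<integral>y. indicator (?A n) y * f y \<partial>\<mu>) \<longlonglongrightarrow> (\<integral>y. f y \<partial>\<mu>)"
    proof (rule integral_dominated_convergence[where w = "\<lambda>_. B"])
      show "AE y in \<mu>. (\<lambda>n. indicator (?A n) y * f y) \<longlonglongrightarrow> f y"
        using AE_E
      proof eventually_elim
        case (elim y)
        then have "\<exists>n. ?s n y > real 0" unfolding E_def by blast
        then obtain m where "?s m y > 0" by auto
        then have pos: "max_birkhoff f m y > 0" using birkhoff_sum_le_max[of f y m] by linarith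
        have "max_birkhoff f n y > 0" if "n \<ge> m" for n
          using pos lift_Suc_mono_le[of "\<lambda>n. max_birkhoff f n y", OF max_birkhoff_mono that] by linarith
        then show ?case
          by (intro tendsto_eventually) (auto simp: eventually_sequentially indicator_def)
      qed
      show "AE y in \<mu>. norm (indicator (?A n) y * f y) \<le> B" for n
        using B by (intro AE_I2) (auto simp: indicator_def abs_mult intro: order_trans[OF abs_ge_zero])
      show "f \<in> borel_measurable \<mu>" by simp
      show "(\<lambda>y. indicator (?A n) y * f y) \<in> borel_measurable \<mu>" for n
        using meas[of n] by simp
    qed simp
    then have "0 \<le> (\<integral>y. f y \<partial>\<mu>)"
      using integral_positive_max_birkhoff[OF f] by (intro LIMSEQ_le_const) auto
    with neg show ?thesis by simp
  qed
qed

text \<open>Subtracting the mean plus \<open>\<delta> / 2\<close> makes the mean negative, so the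
  sums are bounded by some \<open>K\<close> depending on the point, and \<open>K / n\<close>
  eventually drops below the other \<open>\<delta> / 2\<close>.\<close>

lemma birkhoff_average_eventually_le:
  assumes erg: "ergodic_prob S \<mu>" and g: "continuous_on UNIV g" and \<delta>: "\<delta> > 0"
  shows "AE y in \<mu>. \<forall>\<^sub>F n in sequentially. (\<Sum>i<n. g ((S ^^ i) y)) / real n \<le> (\<integral>y. g y \<partial>\<mu>) + \<delta>"
proof -
  let ?c = "(\<integral>y. g y \<partial>\<mu>) + \<delta> / 2"
  have cont: "continuous_on UNIV (\<lambda>y. g y - ?c)" using g by (intro continuous_intros)
  have "(\<integral>y. g y - ?c \<partial>\<mu>) = (\<integral>y. g y \<partial>\<mu>) - ?c"
    using integrable_continuous[OF g] by (subst Bochner_Integration.integral_diff) (auto simp: prob_UNIV)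
  then have "(\<integral>y. g y - ?c \<partial>\<mu>) < 0" using \<delta> by simp
  from birkhoff_sums_bounded_above[OF erg cont this] show ?thesis
  proof eventually_elim
    case (elim y)
    then obtain K where K: "\<And>n. (\<Sum>i<n. g ((S ^^ i) y) - ?c) \<le> K" by blast
    have "\<forall>\<^sub>F n in sequentially. K / real n < \<delta> / 2"
      using lim_const_over_n[of K] \<delta> by (intro order_tendstoD(2)) auto
    then show ?case using eventually_ge_at_top[of 1]
    proof eventually_elim
      case (elim n)
      have "(\<Sum>i<n. g ((S ^^ i) y)) \<le> K + real n * ?c" using K[of n] by (simp add: sum_subtractf)
      then have "(\<Sum>i<n. g ((S ^^ i) y)) / real n \<le> (K + real n * ?c) / real n"
        by (rule divide_right_mono) simp
      also have "\<dots> = K / real n + ?c" using elim(2) by (simp add: add_divide_distrib)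
      finally show ?case using elim(1) by linarith
    qed
  qed
qed

lemma birkhoff_average_eventually_close:
  assumes erg: "ergodic_prob S \<mu>" and g: "continuous_on UNIV g" and \<delta>: "\<delta> > 0"
  shows "AE y in \<mu>. \<forall>\<^sub>F n in sequentially. \<bar>(\<Sum>i<n. g ((S ^^ i) y)) / real n - (\<integral>y. g y \<partial>\<mu>)\<bar> \<le> \<delta>"
proof -
  have "continuous_on UNIV (\<lambda>y. - g y)" using g by (intro continuous_intros)
  from birkhoff_average_eventually_le[OF erg this \<delta>] birkhoff_average_eventually_le[OF erg g \<delta>]
  show ?thesis
  proof eventually_elim
    case (elim y)
    then show ?case by eventually_elim (simp add: sum_negf abs_le_iff)
  qed
qed

text \<open>True orbits have no jumps, so only the finitely many averages matter. They converge
  almost everywhere, and dominated convergence of the indicators turns this into convergence of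
  measures.\<close>

lemma prob_generic_orbits_tendsto:
  assumes erg: "ergodic_prob S \<mu>" and L: "finite L" "\<And>g. g \<in> L \<Longrightarrow> continuous_on UNIV g" and \<delta>: "\<delta> > 0"
  shows "{y. (\<lambda>i\<in>{..<n}. (S ^^ i) y) \<in> generic_pseudo_orbits S n \<delta> \<mu> L} \<in> sets borel"
    and "(\<lambda>n. prob {y. (\<lambda>i\<in>{..<n}. (S ^^ i) y) \<in> generic_pseudo_orbits S n \<delta> \<mu> L}) \<longlonglongrightarrow> 1"
proof -
  let ?G = "\<lambda>n. {y. (\<lambda>i\<in>{..<n}. (S ^^ i) y) \<in> generic_pseudo_orbits S n \<delta> \<mu> L}"
  have eq: "?G n = {y. \<forall>g\<in>L. \<bar>(\<Sum>i<n. g ((S ^^ i) y)) / real n - (\<integral>y. g y \<partial>\<mu>)\<bar> \<le> \<delta>}" for n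
  proof -
    have "(\<Sum>i<n - 1. dist (S ((\<lambda>i\<in>{..<n}. (S ^^ i) y) i)) ((\<lambda>i\<in>{..<n}. (S ^^ i) y) (Suc i))) = 0" for y
      by (intro sum.neutral) auto
    then show ?thesis
      using \<delta> by (simp add: generic_pseudo_orbits_def avg_pseudo_orbits_def)
  qed
  have "closed (?G n)" for n
  proof -
    have "continuous_on UNIV (\<lambda>y. \<bar>(\<Sum>i<n. g ((S ^^ i) y)) / real n - (\<integral>y. g y \<partial>\<mu>)\<bar>)" if "g \<in> L" for g
      using continuous_on_compose2[OF L(2)[OF that] continuous_iterate]
      unfolding divide_inverse by (intro continuous_intros) auto
    then have "closed (\<Inter>g\<in>L. {y. \<bar>(\<Sum>i<n. g ((S ^^ i) y)) / real n - (\<integral>y. g y \<partial>\<mu>)\<bar> \<le> \<delta>})"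
      by (intro closed_INT ballI closed_Collect_le continuous_on_const) auto
    also have "(\<Inter>g\<in>L. {y. \<bar>(\<Sum>i<n. g ((S ^^ i) y)) / real n - (\<integral>y. g y \<partial>\<mu>)\<bar> \<le> \<delta>}) = ?G n"
      unfolding eq by auto
    finally show ?thesis .
  qed
  then show meas: "?G n \<in> sets borel" for n by (rule borel_closed)
  have "(\<lambda>n. \<integral>y. indicator (?G n) y \<partial>\<mu>) \<longlonglongrightarrow> (\<integral>y. (1::real) \<partial>\<mu>)"
  proof (rule integral_dominated_convergence[where w = "\<lambda>_. 1"])
    have "AE y in \<mu>. \<forall>g\<in>L. \<forall>\<^sub>F n in sequentially. \<bar>(\<Sum>i<n. g ((S ^^ i) y)) / real n - (\<integral>y. g y \<partial>\<mu>)\<bar> \<le> \<delta>"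
      using birkhoff_average_eventually_close[OF erg L(2) \<delta>] L(1) by (intro AE_finite_allI) auto
    then show "AE y in \<mu>. (\<lambda>n. indicator (?G n) y) \<longlonglongrightarrow> (1::real)"
    proof eventually_elim
      case (elim y)
      then have "\<forall>\<^sub>F n in sequentially. \<forall>g\<in>L. \<bar>(\<Sum>i<n. g ((S ^^ i) y)) / real n - (\<integral>y. g y \<partial>\<mu>)\<bar> \<le> \<delta>"
        by (intro eventually_ball_finite L(1))
      then have "\<forall>\<^sub>F n in sequentially. indicator (?G n) y = (1::real)"
        by eventually_elim (simp only: eq, simp)
      then show ?case by (rule tendsto_eventually)
    qed
    show "(\<lambda>y. indicator (?G n) y :: real) \<in> borel_measurable \<mu>" for n
      using meas[of n] by simp
  qed (auto simp: indicator_def)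
  then show "(\<lambda>n. prob (?G n)) \<longlonglongrightarrow> 1" using meas by (simp add: prob_space)
qed


section \<open>Pulling covers back to true orbits\<close>

text \<open>Induction over the generated sigma-algebra. Complements are relative to
  \<open>K\<close>, which is where measurability of the preimage of \<open>K\<close> enters.\<close>

lemma vimage_orbit_borel:
  assumes G: "{y. (\<lambda>i\<in>{..<n}. (S ^^ i) y) \<in> K} \<in> sets borel"
    and K: "K \<subseteq> {..<n} \<rightarrow>\<^sub>E UNIV" and V: "V \<in> borel_subsets (subtopology (power_topology n) K)"
  shows "{y. (\<lambda>i\<in>{..<n}. (S ^^ i) y) \<in> V} \<in> sets borel"
proof -
  let ?\<phi> = "\<lambda>y. \<lambda>i\<in>{..<n}. (S ^^ i) y"
  have top: "topspace (subtopology (power_topology n) K) = K" using K by auto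
  from V have "V \<in> sigma_sets K {T. openin (subtopology (power_topology n) K) T}"
    by (simp only: borel_subsets_def top)
  then show ?thesis
  proof induction
    case (Basic T)
    then obtain T' where T': "openin (power_topology n) T'" "T = T' \<inter> K" by (auto simp: openin_subtopology)
    have "openin euclidean {y \<in> topspace euclidean. ?\<phi> y \<in> T'}"
      by (rule openin_continuous_map_preimage[OF continuous_map_orbit T'(1)])
    then have "open {y. ?\<phi> y \<in> T'}" by (simp flip: open_openin)
    then have "{y. ?\<phi> y \<in> T'} \<inter> {y. ?\<phi> y \<in> K} \<in> sets borel" using G by (rule sets.Int[OF borel_open])
    also have "{y. ?\<phi> y \<in> T'} \<inter> {y. ?\<phi> y \<in> K} = {y. ?\<phi> y \<in> T}" using T'(2) by blast
    finally show ?case .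
  next
    case Empty
    show ?case by simp
  next
    case (Compl a)
    have "{y. ?\<phi> y \<in> K - a} = {y. ?\<phi> y \<in> K} - {y. ?\<phi> y \<in> a}" by blast
    then show ?case using G Compl.IH by (simp only: sets.Diff)
  next
    case (Union a)
    have "{y. ?\<phi> y \<in> (\<Union>i. a i)} = (\<Union>i. {y. ?\<phi> y \<in> a i})" by blast
    moreover have "(\<Union>i. {y. ?\<phi> y \<in> a i}) \<in> sets borel"
      by (intro sets.countable_UN image_subsetI Union.IH)
    ultimately show ?case by (simp only:)
  qed
qed

text \<open>Partition \<open>G\<close> by the pulled-back cover and its complement by itineraries,
  so that the entropy of the whole bounds \<open>cover_entropy\<close>. Gibbs' inequality is applied
  to each part, with the suprema and with the constant 1 as weights. Each application leaves a term
  of the form \<open>- x * ln x\<close> of size at most 1, which explains the 2; the division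
  reflects that the pieces in \<open>G\<close> have mass \<open>prob G\<close> only.\<close>

lemma cover_sum_ge:
  assumes U: "\<U> \<in> open_covers euclidean" and F: "block_subadditive F" and n: "n \<ge> 1"
    and C: "C \<ge> 0" "\<And>n x. block_potential F n x \<le> real n * C"
    and V: "\<V> \<in> covers (subtopology (power_topology n) (generic_pseudo_orbits S n \<delta> \<mu> L))"
    "finer \<V> (cover_power \<U> n)"
  defines "G \<equiv> {y. (\<lambda>i\<in>{..<n}. (S ^^ i) y) \<in> generic_pseudo_orbits S n \<delta> \<mu> L}"
  assumes G: "G \<in> sets borel" "prob G > 0"
  shows "ennreal (exp ((cover_entropy \<mu> (iterated_join S \<U> n) + mean_block_potential F n
      - real n * (1 - prob G) * (C + ln (real (card \<U>))) - 2) / prob G))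
    \<le> (\<Sum>V\<in>\<V>. SUP x\<in>V. ennreal (exp (F n x)))"
proof -
  let ?\<phi> = "\<lambda>y. \<lambda>i\<in>{..<n}. (S ^^ i) y"
  define K where "K = generic_pseudo_orbits S n \<delta> \<mu> L"
  let ?X = "subtopology (power_topology n) K"
  have K: "K \<subseteq> {..<n} \<rightarrow>\<^sub>E UNIV" by (auto simp: K_def generic_pseudo_orbits_def avg_pseudo_orbits_def)
  have \<V>: "finite \<V>" "\<And>V. V \<in> \<V> \<Longrightarrow> V \<in> borel_subsets ?X" "\<Union>\<V> = K"
    using V(1) unfolding covers_def topspace_generic K_def by auto
  have G_eq: "G = {y. ?\<phi> y \<in> K}" by (simp add: G_def K_def)
  have fin_words: "finite (words \<U> n)" by (rule finite_words[OF open_coversD(2)[OF U]])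
  define q where "q = 1 - prob G"
  have "prob (UNIV - G) = q" using G(1) prob_compl[of G] by (simp add: q_def)
  have "{y. ?\<phi> y \<in> V} \<in> sets borel" if "V \<in> \<V>" for V
    using G(1) unfolding G_eq by (rule vimage_orbit_borel[OF _ K \<V>(2)[OF that]])
  from finite_disjointification[of \<V> "\<lambda>V. {y. ?\<phi> y \<in> V}" borel, OF \<V>(1) this]
  obtain D where D: "\<And>V. V \<in> \<V> \<Longrightarrow> D V \<in> sets borel" "\<And>V. V \<in> \<V> \<Longrightarrow> D V \<subseteq> {y. ?\<phi> y \<in> V}"
    "disjoint_family_on D \<V>" "(\<Union>V\<in>\<V>. D V) = (\<Union>V\<in>\<V>. {y. ?\<phi> y \<in> V})" by auto
  have D_un: "(\<Union>V\<in>\<V>. D V) = G" unfolding D(4) G_eq using \<V>(3) by auto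
  have "itinerary S n w - G \<in> sets borel" if "w \<in> words \<U> n" for w
  proof -
    have "itinerary S n w \<in> iterated_join S \<U> n" using that by (auto simp: iterated_join_eq words_def)
    then have "itinerary S n w \<in> sets borel"
      using iterated_join_covers[OF open_coversD(1)[OF U], of n] by (auto simp: covers_euclidean_iff)
    then show ?thesis using G(1) by (rule sets.Diff)
  qed
  from finite_disjointification[of "words \<U> n" "\<lambda>w. itinerary S n w - G" borel, OF fin_words this]
  obtain E where E: "\<And>w. w \<in> words \<U> n \<Longrightarrow> E w \<in> sets borel"
    "\<And>w. w \<in> words \<U> n \<Longrightarrow> E w \<subseteq> itinerary S n w - G"
    "disjoint_family_on E (words \<U> n)" "(\<Union>w\<in>words \<U> n. E w) = (\<Union>w\<in>words \<U> n. itinerary S n w - G)" by auto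
  have "(\<Union>w\<in>words \<U> n. itinerary S n w) = UNIV"
    using iterated_join_covers[OF open_coversD(1)[OF U], of n]
    by (simp add: covers_euclidean_iff iterated_join_eq words_def)
  then have E_un: "(\<Union>w\<in>words \<U> n. E w) = UNIV - G" unfolding E(4) by blast
  \<comment> \<open>A disjoint sum as index set joins the two families without identifying pieces
    that happen to be equal.\<close>
  define X where "X = case_sum D E"
  have X_simps: "X (Inl V) = D V" "X (Inr w) = E w" for V w by (simp_all add: X_def)
  have DE: "D V \<inter> E w = {}" if "V \<in> \<V>" "w \<in> words \<U> n" for V w
    using that E(2) D_un by blast
  let ?\<eta> = "\<lambda>A. - (prob A * ln (prob A))"
  have "cover_entropy \<mu> (iterated_join S \<U> n) \<le> (\<Sum>i\<in>\<V> <+> words \<U> n. ?\<eta> (X i))"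
  proof (rule cover_entropy_le_indexed)
    show "finite (\<V> <+> words \<U> n)" using \<V>(1) fin_words by simp
    show "X i \<in> sets borel" if "i \<in> \<V> <+> words \<U> n" for i
      using that D(1) E(1) by (auto simp: X_simps)
    show "disjoint_family_on X (\<V> <+> words \<U> n)"
      unfolding disjoint_family_on_def
    proof (intro ballI impI)
      fix i j assume ij: "i \<in> \<V> <+> words \<U> n" "j \<in> \<V> <+> words \<U> n" "i \<noteq> j"
      show "X i \<inter> X j = {}"
      proof (cases i; cases j)
        fix V V' assume "i = Inl V" "j = Inl V'"
        then show ?thesis using ij disjoint_family_onD[OF D(3), of V V'] by (simp add: X_simps Plus_def image_iff)
      next
        fix w w' assume "i = Inr w" "j = Inr w'"
        then show ?thesis using ij disjoint_family_onD[OF E(3), of w w'] by (simp add: X_simps Plus_def image_iff)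
      next
        fix V w assume "i = Inl V" "j = Inr w"
        then show ?thesis using ij DE[of V w] by (simp add: X_simps Plus_def image_iff)
      next
        fix w V assume "i = Inr w" "j = Inl V"
        then show ?thesis using ij DE[of V w] by (simp add: X_simps Plus_def image_iff Int_commute)
      qed
    qed
    have "(\<Union>i\<in>\<V> <+> words \<U> n. X i) = (\<Union>V\<in>\<V>. D V) \<union> (\<Union>w\<in>words \<U> n. E w)"
      unfolding Plus_def UN_Un by (simp add: X_simps)
    then show "(\<Union>i\<in>\<V> <+> words \<U> n. X i) = UNIV" using D_un E_un by simp
    fix i assume "i \<in> \<V> <+> words \<U> n"
    then consider V where "V \<in> \<V>" "i = Inl V" | w where "w \<in> words \<U> n" "i = Inr w" by auto
    then show "\<exists>W\<in>iterated_join S \<U> n. X i \<subseteq> W"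
    proof cases
      case (1 V)
      then have "\<exists>P\<in>cover_power \<U> n. V \<subseteq> P" using V(2) by (simp add: finer_def)
      then obtain W where W: "\<forall>i<n. W i \<in> \<U>" "V \<subseteq> Pi\<^sub>E {..<n} W" by (auto simp: cover_power_def)
      have "D V \<subseteq> itinerary S n (restrict W {..<n})"
      proof
        fix y assume "y \<in> D V"
        then have "?\<phi> y \<in> Pi\<^sub>E {..<n} W" using D(2)[OF 1(1)] W(2) by blast
        then show "y \<in> itinerary S n (restrict W {..<n})" by (auto simp: itinerary_def PiE_iff)
      qed
      moreover have "restrict W {..<n} \<in> {..<n} \<rightarrow>\<^sub>E \<U>" using W(1) by auto
      ultimately show ?thesis unfolding iterated_join_eq 1(2) X_simps by blast
    next
      case (2 w)
      then have "E w \<subseteq> itinerary S n w" using E(2) by blast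
      then show ?thesis using 2(1) unfolding iterated_join_eq 2(2) X_simps words_def by blast
    qed
  qed
  also have "\<dots> = (\<Sum>V\<in>\<V>. ?\<eta> (D V)) + (\<Sum>w\<in>words \<U> n. ?\<eta> (E w))"
    using \<V>(1) fin_words by (simp add: sum.Plus X_simps comp_def)
  finally have H_le: "cover_entropy \<mu> (iterated_join S \<U> n) \<le>
    (\<Sum>V\<in>\<V>. ?\<eta> (D V)) + (\<Sum>w\<in>words \<U> n. ?\<eta> (E w))" .
  have sumD: "(\<Sum>V\<in>\<V>. prob (D V)) = prob G"
    unfolding D_un[symmetric] using D(1,3) \<V>(1) by (subst finite_measure_finite_Union) auto
  have "(\<Sum>w\<in>words \<U> n. prob (E w)) = prob (UNIV - G)"
    unfolding E_un[symmetric] using E(1,3) fin_words by (subst finite_measure_finite_Union) auto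
  then have sumE: "(\<Sum>w\<in>words \<U> n. prob (E w)) = q" using \<open>prob (UNIV - G) = q\<close> by simp
  have q: "q \<ge> 0" by (simp add: q_def)
  have cU: "card \<U> > 0" using open_coversD(2,5)[OF U] by (simp add: card_gt_0_iff)
  \<comment> \<open>With weight 1 on every word, the total is the number of words, so the complement
    of \<open>G\<close> contributes at most its mass times \<open>n * ln (card \<U>)\<close>, up to
    1.\<close>
  have "(\<Sum>w\<in>words \<U> n. prob (E w) * (ln 1 - ln (prob (E w)))) \<le>
      sum (\<lambda>w. prob (E w)) (words \<U> n) * ln (\<Sum>w\<in>words \<U> n. 1)
      - sum (\<lambda>w. prob (E w)) (words \<U> n) * ln (sum (\<lambda>w. prob (E w)) (words \<U> n))"
    by (rule gibbs_inequality[OF fin_words]) auto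
  also have "\<dots> = q * (real n * ln (real (card \<U>))) - q * ln q"
    unfolding sumE using cU by (simp add: words_def card_PiE ln_realpow)
  also have "\<dots> \<le> q * (real n * ln (real (card \<U>))) + 1" using neg_mult_ln_le_one[OF q] by simp
  finally have E_le: "(\<Sum>w\<in>words \<U> n. ?\<eta> (E w)) \<le> q * (real n * ln (real (card \<U>))) + 1" by simp
  have F_eq: "F n x = block_potential F n x" if "x \<in> K" for x
  proof -
    have "restrict x {..<n} = x" using K that by (intro PiE_restrict) auto
    then show ?thesis using n by (simp add: block_potential_def)
  qed
  \<comment> \<open>Real versions of the suprema; they are finite because the potential is at most
    \<open>n * C\<close> on \<open>K\<close>.\<close>
  define s where "s = (\<lambda>V. enn2real (SUP x\<in>V. ennreal (exp (F n x))))"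
  have s_enn: "ennreal (s V) = (SUP x\<in>V. ennreal (exp (F n x)))" if "V \<in> \<V>" for V
  proof -
    have "V \<subseteq> K" using \<V>(3) that by blast
    then have "(SUP x\<in>V. ennreal (exp (F n x))) \<le> ennreal (exp (real n * C))"
      using C(2) F_eq by (intro SUP_least ennreal_leI) auto
    also have "\<dots> < top" by simp
    finally show ?thesis by (simp add: s_def)
  qed
  have s_ge: "exp (F n x) \<le> s V" if "V \<in> \<V>" "x \<in> V" for V x
  proof -
    have "ennreal (exp (F n x)) \<le> ennreal (s V)"
      unfolding s_enn[OF that(1)] using that(2) by (rule SUP_upper)
    then show ?thesis by (subst (asm) ennreal_le_iff) (simp_all add: s_def)
  qed
  have s_pos: "s V > 0" if "V \<in> \<V>" "prob (D V) > 0" for V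
  proof -
    have "D V \<noteq> {}" using that(2) by auto
    then obtain y where y: "y \<in> D V" by blast
    have "?\<phi> y \<in> V" using D(2)[OF that(1)] y by blast
    with s_ge[OF that(1)] show ?thesis using exp_gt_zero less_le_trans by blast
  qed
  define Z where "Z = (\<Sum>V\<in>\<V>. s V)"
  have "(\<Sum>V\<in>\<V>. prob (D V) * (ln (s V) - ln (prob (D V)))) \<le>
      sum (\<lambda>V. prob (D V)) \<V> * ln (sum s \<V>) - sum (\<lambda>V. prob (D V)) \<V> * ln (sum (\<lambda>V. prob (D V)) \<V>)"
    by (rule gibbs_inequality[OF \<V>(1)]) (use s_pos in \<open>auto simp: s_def\<close>)
  also have "\<dots> \<le> prob G * ln Z + 1"
    unfolding sumD Z_def using neg_mult_ln_le_one[of "prob G"] by simp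
  finally have D_le: "(\<Sum>V\<in>\<V>. ?\<eta> (D V)) + (\<Sum>V\<in>\<V>. prob (D V) * ln (s V)) \<le> prob G * ln Z + 1"
    by (simp add: right_diff_distrib sum_subtractf sum_negf)
  let ?f = "\<lambda>y. block_potential F n (\<lambda>l. (S ^^ l) y)"
  \<comment> \<open>On a piece of \<open>G\<close> the supremum over its cover element dominates the
    potential; outside \<open>G\<close> the linear bound does. Integrating compares the mean
    potential with the same weights as in Gibbs' inequality.\<close>
  have pw: "?f y \<le> (\<Sum>V\<in>\<V>. indicator (D V) y * ln (s V)) + indicator (UNIV - G) y * (real n * C)" for y
  proof (cases "y \<in> G")
    case True
    then obtain V where V': "V \<in> \<V>" "y \<in> D V" using D_un by blast
    have "indicator (D V') y = (if V' = V then 1 else 0 :: real)" if "V' \<in> \<V>" for V'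
      using disjoint_family_onD[OF D(3) that V'(1)] V'(2) by (auto simp: indicator_def)
    then have "(\<Sum>V'\<in>\<V>. indicator (D V') y * ln (s V')) = (\<Sum>V'\<in>\<V>. if V' = V then ln (s V') else 0)"
      by (intro sum.cong) auto
    also have "\<dots> = ln (s V)" using V'(1) \<V>(1) by simp
    finally have "(\<Sum>V'\<in>\<V>. indicator (D V') y * ln (s V')) = ln (s V)" .
    moreover have "?\<phi> y \<in> V" using D(2)[OF V'(1)] V'(2) by blast
    then have "exp (F n (?\<phi> y)) \<le> s V" by (rule s_ge[OF V'(1)])
    then have "ln (exp (F n (?\<phi> y))) \<le> ln (s V)" by (intro ln_mono) auto
    moreover have "F n (?\<phi> y) = ?f y" using n by (simp add: block_potential_def)
    ultimately show ?thesis using True by simp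
  next
    case False
    then have "indicator (D V) y = (0::real)" if "V \<in> \<V>" for V
      using that D_un by (auto simp: indicator_def)
    then have "(\<Sum>V\<in>\<V>. indicator (D V) y * ln (s V)) = 0" by (intro sum.neutral) simp
    then show ?thesis using False C(2) by simp
  qed
  have int_ind: "integrable \<mu> (\<lambda>y. indicator A y * r)" if "A \<in> sets borel" for A and r :: real
    using that by (intro integrable_mult_left integrable_real_indicator) (auto simp: emeasure_eq_measure)
  have meas_Gc: "UNIV - G \<in> sets borel" using G(1) by auto
  have "mean_block_potential F n \<le>
      (\<integral>y. (\<Sum>V\<in>\<V>. indicator (D V) y * ln (s V)) + indicator (UNIV - G) y * (real n * C) \<partial>\<mu>)"
    unfolding mean_block_potential_def
    by (intro integral_mono integrable_continuous continuous_block_potential_orbit[OF F]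
        Bochner_Integration.integrable_add Bochner_Integration.integrable_sum int_ind D(1) meas_Gc pw)
  also have "\<dots> = (\<integral>y. (\<Sum>V\<in>\<V>. indicator (D V) y * ln (s V)) \<partial>\<mu>)
      + (\<integral>y. indicator (UNIV - G) y * (real n * C) \<partial>\<mu>)"
    by (intro Bochner_Integration.integral_add Bochner_Integration.integrable_sum int_ind D(1) meas_Gc)
  also have "(\<integral>y. (\<Sum>V\<in>\<V>. indicator (D V) y * ln (s V)) \<partial>\<mu>) = (\<Sum>V\<in>\<V>. prob (D V) * ln (s V))"
  proof -
    have "(\<integral>y. (\<Sum>V\<in>\<V>. indicator (D V) y * ln (s V)) \<partial>\<mu>) = (\<Sum>V\<in>\<V>. \<integral>y. indicator (D V) y * ln (s V) \<partial>\<mu>)"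
      by (rule Bochner_Integration.integral_sum) (intro int_ind D(1))
    also have "\<dots> = (\<Sum>V\<in>\<V>. prob (D V) * ln (s V))"
      using D(1) by (intro sum.cong refl) simp
    finally show ?thesis .
  qed
  also have "(\<integral>y. indicator (UNIV - G) y * (real n * C) \<partial>\<mu>) = q * (real n * C)"
    using meas_Gc \<open>prob (UNIV - G) = q\<close> by simp
  finally have f_le: "mean_block_potential F n \<le> (\<Sum>V\<in>\<V>. prob (D V) * ln (s V)) + q * (real n * C)" .
  let ?T = "cover_entropy \<mu> (iterated_join S \<U> n) + mean_block_potential F n
      - real n * (1 - prob G) * (C + ln (real (card \<U>))) - 2"
  have "?T \<le> prob G * ln Z"
  proof -
    have "real n * (1 - prob G) * (C + ln (real (card \<U>))) = q * (real n * C) + q * (real n * ln (real (card \<U>)))"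
      by (simp add: q_def algebra_simps)
    then show ?thesis using H_le E_le D_le f_le by linarith
  qed
  then have "?T / prob G \<le> ln Z" using G(2) by (simp add: pos_divide_le_eq mult.commute)
  moreover have "Z > 0"
  proof -
    obtain V where V': "V \<in> \<V>" "prob (D V) > 0"
      using G(2) sumD by (metis less_irrefl sum_nonpos not_less)
    then show ?thesis unfolding Z_def using \<V>(1) s_pos by (intro sum_pos2[of \<V> V]) (auto simp: s_def)
  qed
  ultimately have "exp (?T / prob G) \<le> Z" by (simp add: ln_ge_iff)
  then have "ennreal (exp (?T / prob G)) \<le> ennreal Z" by (rule ennreal_leI)
  also have "ennreal Z = (\<Sum>V\<in>\<V>. ennreal (s V))" unfolding Z_def by (rule sum_ennreal[symmetric]) (simp add: s_def)
  also have "\<dots> = (\<Sum>V\<in>\<V>. SUP x\<in>V. ennreal (exp (F n x)))" by (intro sum.cong refl s_enn)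
  finally show ?thesis .
qed

text \<open>The estimate for a single cover is uniform over all admissible covers, hence it passes
  to the infimum. After division by \<open>n\<close> the correction is \<open>1 - prob (G n)\<close>
  times a constant and tends to 0.\<close>

lemma GP_delta_ge:
  assumes erg: "ergodic_prob S \<mu>" and U: "\<U> \<in> open_covers euclidean" and F: "block_subadditive F"
    and P: "potential_mean \<mu> (induced_potential S F) = ereal P"
    and L: "finite L" "\<And>g. g \<in> L \<Longrightarrow> continuous_on UNIV g" and \<delta>: "\<delta> > 0"
  shows "ereal (local_entropy \<mu> S \<U> + P) \<le> GP_delta S F \<U> \<delta> \<mu> L"
proof -
  let ?h = "local_entropy \<mu> S \<U>"
  obtain C where C: "C \<ge> 0" "\<And>n x. block_potential F n x \<le> real n * C"
    using block_potential_linear_bound[OF compact_UNIV F] by blast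
  define G where "G = (\<lambda>n. {y. (\<lambda>i\<in>{..<n}. (S ^^ i) y) \<in> generic_pseudo_orbits S n \<delta> \<mu> L})"
  have G: "G n \<in> sets borel" "(\<lambda>n. prob (G n)) \<longlonglongrightarrow> 1" for n
    using prob_generic_orbits_tendsto[OF erg L \<delta>] by (auto simp: G_def)
  let ?H = "\<lambda>n. cover_entropy \<mu> (iterated_join S \<U> n)"
  let ?c = "C + ln (real (card \<U>))"
  \<comment> \<open>\<open>T'\<close> is \<open>T\<close> divided by \<open>n\<close>, arranged so
    that every ingredient has a known limit.\<close>
  define T where "T = (\<lambda>n. (?H n + mean_block_potential F n - real n * (1 - prob (G n)) * ?c - 2) / prob (G n))"
  define T' where "T' = (\<lambda>n. (?H n / real n + mean_block_potential F n / real n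
      - (1 - prob (G n)) * ?c - 2 / real n) / prob (G n))"
  have "(\<lambda>n. mean_block_potential F n / real n) \<longlonglongrightarrow> P"
    using potential_mean_tendsto(1)[OF F] by (simp add: P)
  then have "T' \<longlonglongrightarrow> (?h + P - (1 - 1) * ?c - 0) / 1"
    unfolding T'_def using local_entropy_tendsto[OF open_coversD(1)[OF U]] G(2)
    by (intro tendsto_intros lim_const_over_n) auto
  then have lim: "(\<lambda>n. ereal (T' n)) \<longlonglongrightarrow> ereal (?h + P)" by simp
  have "\<forall>\<^sub>F n in sequentially. prob (G n) > 0" using G(2) by (rule order_tendstoD(1)) simp
  then have "\<forall>\<^sub>F n in sequentially. ereal (T' n) \<le> ext_log (GP_n S F \<U> n \<delta> \<mu> L) / ereal (real n)"
    using eventually_ge_at_top[of 1]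
  proof eventually_elim
    case (elim n)
    have "ennreal (exp (T n)) \<le> GP_n S F \<U> n \<delta> \<mu> L"
      unfolding GP_n_def Let_def T_def G_def
      by (intro INF_greatest cover_sum_ge[OF U F elim(2) C])
        (use G(1)[of n] elim(1) in \<open>auto simp: G_def\<close>)
    then have "ereal (T n) \<le> ext_log (GP_n S F \<U> n \<delta> \<mu> L)" by (rule ext_log_ge)
    then have "ereal (T n) / ereal (real n) \<le> ext_log (GP_n S F \<U> n \<delta> \<mu> L) / ereal (real n)"
      using elim(2) by (intro ereal_divide_right_mono) auto
    moreover have "T n / real n = T' n"
      using elim by (simp add: T_def T'_def field_simps)
    ultimately show ?case using elim(2) by simp
  qed
  then have "limsup (\<lambda>n. ereal (T' n)) \<le> GP_delta S F \<U> \<delta> \<mu> L"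
    unfolding GP_delta_def by (rule Limsup_mono)
  with lim_imp_Limsup[OF sequentially_bot lim] show ?thesis by simp
qed

lemma GP_ge:
  assumes "ergodic_prob S \<mu>" "\<U> \<in> open_covers euclidean" "block_subadditive F"
    "potential_mean \<mu> (induced_potential S F) = ereal P"
  shows "ereal (local_entropy \<mu> S \<U> + P) \<le> GP S F \<U> \<mu>"
  unfolding GP_def using GP_delta_ge[OF assms] by (intro INF_greatest) auto

end

theorem theorem1p2:
  fixes S :: "'a::metric_space \<Rightarrow> 'a"
    and F :: "nat \<Rightarrow> (nat \<Rightarrow> 'a) \<Rightarrow> real"
    and \<mu> :: "'a measure"
    and \<U> :: "'a set set"
  assumes "tds S"
    and "block_subadditive F"
    and "invariant_prob S \<mu>"
    and "\<U> \<in> open_covers euclidean"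
    and "potential_mean \<mu> (induced_potential S F) > -\<infinity>"
  shows "GP S F \<U> \<mu> \<le> ereal (local_entropy \<mu> S \<U>) + potential_mean \<mu> (induced_potential S F)
    \<and> (ergodic_prob S \<mu> \<longrightarrow>
        GP S F \<U> \<mu> = ereal (local_entropy \<mu> S \<U>) + potential_mean \<mu> (induced_potential S F))"
proof -
  interpret invariant_system S \<mu> using assms(1,3) by unfold_locales
  \<comment> \<open>The bound by the term for \<open>n = 1\<close> excludes
    \<open>\<infinity>\<close>; together with the assumption, the mean potential is a real
    number.\<close>
  have "potential_mean \<mu> (induced_potential S F) \<le> ereal (mean_block_potential F 1 / real 1)"
    by (rule potential_mean_tendsto(2)[OF assms(2)]) simp
  then obtain P where P: "potential_mean \<mu> (induced_potential S F) = ereal P"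
    using assms(5) by (cases "potential_mean \<mu> (induced_potential S F)") auto
  show ?thesis
    using GP_le[OF assms(4,2) P] GP_ge[OF _ assms(4,2) P] by (auto simp: P intro: antisym)
qed

end
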